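(* Let $\mathfrak{g}=\mathfrak{sl}_2(\mathbb{C})$ and let $\mathfrak{s}=\mathfrak{g}\ltimes\mathfrak{H}$ be the Schrödinger Lie algebra. Let $V$ be a simple infinite-dimensional $\mathfrak{g}$-Harish-Chandra module for $\mathfrak{s}$. Then \[ \operatorname{Ext}^1(V,V)\cong\mathbb{C}, \] where $\operatorname{Ext}^1$ is taken in the category of $\mathfrak{s}$-modules.
   Context: Everything is over $\mathbb{C}$. The Schrödinger Lie algebra $\mathfrak{s}$ has basis $\{e,h,f,p,q,z\}$, where $e,h,f$ satisfy the usual relations of $\mathfrak{g}=\mathfrak{sl}_2$, $z$ is central, and $[e,p]=0$, $[h,p]=p$, $[f,p]=q$, $[e,q]=p$, $[h,q]=-q$, $[f,q]=0$, $[p,q]=z$; $\mathfrak{H}=\mathrm{span}\{p,q,z\}$. An $\mathfrak{s}$-module is a $\mathfrak{g}$-Harish-Chandra module if its restriction to $\mathfrak{g}$ is a direct sum of simple finite-dimensional $\mathfrak{g}$-modules, each isomorphism class occurring with finite multiplicity. *)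

theory Defs
  imports "HOL-Analysis.Analysis"
begin

section \<open>The Schroedinger Lie algebra\<close>

datatype schr_basis = Be | Bh | Bf | Bp | Bq | Bz

lemma UNIV_basis: "(UNIV :: schr_basis set) = {Be, Bh, Bf, Bp, Bq, Bz}"
  using schr_basis.exhaust by auto

instance schr_basis :: finite
  by standard (simp add: UNIV_basis)

type_synonym schr = "complex ^ schr_basis"

abbreviation b_e :: schr where "b_e \<equiv> axis Be 1"
abbreviation b_h :: schr where "b_h \<equiv> axis Bh 1"
abbreviation b_f :: schr where "b_f \<equiv> axis Bf 1"
abbreviation b_p :: schr where "b_p \<equiv> axis Bp 1"
abbreviation b_q :: schr where "b_q \<equiv> axis Bq 1"
abbreviation b_z :: schr where "b_z \<equiv> axis Bz 1"

text \<open>One orientation of each nonzero bracket of basis vectors; \<open>bracket\<close> below is the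
  bilinear alternating extension of this table.\<close>

fun bracket_table :: "schr_basis \<Rightarrow> schr_basis \<Rightarrow> schr" where
  "bracket_table Be Bf = b_h"
| "bracket_table Bh Be = 2 *s b_e"
| "bracket_table Bh Bf = - 2 *s b_f"
| "bracket_table Bh Bp = b_p"
| "bracket_table Bf Bp = b_q"
| "bracket_table Be Bq = b_p"
| "bracket_table Bh Bq = - b_q"
| "bracket_table Bp Bq = b_z"
| "bracket_table _ _ = 0"

definition bracket :: "schr \<Rightarrow> schr \<Rightarrow> schr" where
  "bracket x y =
     (\<Sum>i\<in>UNIV. \<Sum>j\<in>UNIV. (x $ i * y $ j) *s (bracket_table i j - bracket_table j i))"

lemma bracket_basis:
  "bracket (axis i 1) (axis j 1) = bracket_table i j - bracket_table j i"
proof -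
  have "bracket (axis i 1) (axis j 1) =
      (\<Sum>k\<in>UNIV. \<Sum>l\<in>UNIV. if k = i then (if l = j then bracket_table k l - bracket_table l k else 0) else 0)"
    unfolding bracket_def by (intro sum.cong refl) (auto simp: axis_def)
  also have "\<dots> = bracket_table i j - bracket_table j i"
    by (simp add: UNIV_basis) (cases i; cases j; simp)
  finally show ?thesis .
qed

lemma bracket_alternating: "bracket x x = 0"
  by (simp add: bracket_def UNIV_basis vec_eq_iff algebra_simps)

lemma bracket_jacobi:
  "bracket x (bracket y w) + bracket y (bracket w x) + bracket w (bracket x y) = 0"
  apply (simp add: vec_eq_iff)
  apply (rule allI)
  subgoal for i
    by (cases i) (simp_all add: bracket_def UNIV_basis axis_def algebra_simps)
  done

definition sl2 :: "schr set" where
  "sl2 = vec.span {b_e, b_h, b_f}"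


section \<open>Modules\<close>

text \<open>The underlying abelian group of a module is its type; the record carries the complex scalar
  multiplication and the action of the Lie algebra.\<close>

record 'v smodule =
  scl :: "complex \<Rightarrow> 'v \<Rightarrow> 'v"
  act :: "schr \<Rightarrow> 'v \<Rightarrow> 'v"

definition is_smodule :: "'v::ab_group_add smodule \<Rightarrow> bool" where
  "is_smodule M \<longleftrightarrow>
     vector_space (scl M) \<and>
     (\<forall>a. Vector_Spaces.linear (scl M) (scl M) (act M a)) \<and>
     (\<forall>v. Vector_Spaces.linear (*s) (scl M) (\<lambda>a. act M a v)) \<and>
     (\<forall>a b v. act M (bracket a b) v = act M a (act M b v) - act M b (act M a v))"

text \<open>In the following notions \<open>L\<close> is the set of Lie algebra elements that act: \<open>UNIV\<close> for
  modules over the whole algebra, \<open>sl2\<close> for restrictions to its Levi subalgebra.\<close>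

definition submodule :: "schr set \<Rightarrow> 'v::ab_group_add smodule \<Rightarrow> 'v set \<Rightarrow> bool" where
  "submodule L M W \<longleftrightarrow> module.subspace (scl M) W \<and> (\<forall>a\<in>L. \<forall>w\<in>W. act M a w \<in> W)"

definition simple_submodule :: "schr set \<Rightarrow> 'v::ab_group_add smodule \<Rightarrow> 'v set \<Rightarrow> bool" where
  "simple_submodule L M W \<longleftrightarrow>
     submodule L M W \<and> W \<noteq> {0} \<and> (\<forall>U. U \<subseteq> W \<and> submodule L M U \<longrightarrow> U = {0} \<or> U = W)"

definition simple_smodule :: "'v::ab_group_add smodule \<Rightarrow> bool" where
  "simple_smodule M \<longleftrightarrow> simple_submodule UNIV M UNIV"

definition fin_dim :: "'v::ab_group_add smodule \<Rightarrow> 'v set \<Rightarrow> bool" where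
  "fin_dim M W \<longleftrightarrow> (\<exists>B. finite B \<and> module.span (scl M) B = W)"

definition hom_on ::
  "schr set \<Rightarrow> 'v::ab_group_add smodule \<Rightarrow> 'v set \<Rightarrow> 'w::ab_group_add smodule \<Rightarrow> ('v \<Rightarrow> 'w) \<Rightarrow> bool" where
  "hom_on L M W N \<phi> \<longleftrightarrow>
     (\<forall>x\<in>W. \<forall>y\<in>W. \<phi> (x + y) = \<phi> x + \<phi> y) \<and>
     (\<forall>c. \<forall>x\<in>W. \<phi> (scl M c x) = scl N c (\<phi> x)) \<and>
     (\<forall>a\<in>L. \<forall>x\<in>W. \<phi> (act M a x) = act N a (\<phi> x))"

abbreviation smodule_hom ::
  "'v::ab_group_add smodule \<Rightarrow> 'w::ab_group_add smodule \<Rightarrow> ('v \<Rightarrow> 'w) \<Rightarrow> bool" where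
  "smodule_hom M N \<phi> \<equiv> hom_on UNIV M UNIV N \<phi>"

definition isomorphic_submodules ::
  "schr set \<Rightarrow> 'v::ab_group_add smodule \<Rightarrow> 'v set \<Rightarrow> 'v set \<Rightarrow> bool" where
  "isomorphic_submodules L M W W' \<longleftrightarrow> (\<exists>\<phi>. hom_on L M W M \<phi> \<and> bij_betw \<phi> W W')"

text \<open>Internal direct sums. The summands used below are nonzero, so independent ones are pairwise
  distinct and a set of subspaces suffices as index.\<close>

definition is_direct_sum :: "'v::ab_group_add smodule \<Rightarrow> 'v set set \<Rightarrow> bool" where
  "is_direct_sum M \<W> \<longleftrightarrow>
     module.span (scl M) (\<Union>\<W>) = UNIV \<and>
     (\<forall>\<F> w. finite \<F> \<and> \<F> \<subseteq> \<W> \<and> (\<forall>W\<in>\<F>. w W \<in> W) \<and> (\<Sum>W\<in>\<F>. w W) = 0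
        \<longrightarrow> (\<forall>W\<in>\<F>. w W = 0))"

definition harish_chandra :: "'v::ab_group_add smodule \<Rightarrow> bool" where
  "harish_chandra M \<longleftrightarrow>
     (\<exists>\<W>. is_direct_sum M \<W> \<and>
        (\<forall>W\<in>\<W>. simple_submodule sl2 M W \<and> fin_dim M W) \<and>
        (\<forall>W\<in>\<W>. finite {W'\<in>\<W>. isomorphic_submodules sl2 M W W'}))"

definition prod_smodule ::
  "'v::ab_group_add smodule \<Rightarrow> 'w::ab_group_add smodule \<Rightarrow> ('v \<times> 'w) smodule" where
  "prod_smodule M N =
     \<lparr>scl = (\<lambda>c (x, y). (scl M c x, scl N c y)), act = (\<lambda>a (x, y). (act M a x, act N a y))\<rparr>"


section \<open>Yoneda extensions\<close>

text \<open>An element of \<open>('e, 'm, 'n) extension\<close> stands for a sequence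
  \<open>0 \<rightarrow> N \<rightarrow> E \<rightarrow> M \<rightarrow> 0\<close> with \<open>E\<close> on the type \<open>'e\<close>.\<close>

record ('e, 'm, 'n) extension =
  mid :: "'e smodule"
  inc :: "'n \<Rightarrow> 'e"
  prj :: "'e \<Rightarrow> 'm"

definition is_extension ::
  "'m::ab_group_add smodule \<Rightarrow> 'n::ab_group_add smodule \<Rightarrow>
   ('e::ab_group_add, 'm, 'n) extension \<Rightarrow> bool" where
  "is_extension M N X \<longleftrightarrow>
     is_smodule (mid X) \<and>
     smodule_hom N (mid X) (inc X) \<and> inj (inc X) \<and>
     smodule_hom (mid X) M (prj X) \<and> surj (prj X) \<and>
     range (inc X) = {x. prj X x = 0}"

definition ext_equiv ::
  "('e::ab_group_add, 'm, 'n) extension \<Rightarrow> ('f::ab_group_add, 'm, 'n) extension \<Rightarrow> bool" where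
  "ext_equiv X Y \<longleftrightarrow>
     (\<exists>\<phi>. smodule_hom (mid X) (mid Y) \<phi> \<and> bij \<phi> \<and>
        (\<forall>n. \<phi> (inc X n) = inc Y n) \<and> (\<forall>x. prj Y (\<phi> x) = prj X x))"

text \<open>\<open>Y\<close> is the Baer sum of \<open>X1\<close> and \<open>X2\<close>: the pullback of \<open>mid X1\<close> and \<open>mid X2\<close> over the common
  quotient, modulo the skew diagonal \<open>{(inc X1 n, - inc X2 n)}\<close>, with the induced maps.
  The quotient is presented by a surjection with that kernel.\<close>

definition pullback :: "('e, 'm, 'n) extension \<Rightarrow> ('f, 'm, 'n) extension \<Rightarrow> ('e \<times> 'f) set" where
  "pullback X1 X2 = {(x, y). prj X1 x = prj X2 y}"

definition is_baer_sum ::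
  "('e::ab_group_add, 'm, 'n) extension \<Rightarrow> ('f::ab_group_add, 'm, 'n) extension \<Rightarrow>
   ('g::ab_group_add, 'm, 'n) extension \<Rightarrow> bool" where
  "is_baer_sum X1 X2 Y \<longleftrightarrow>
     (\<exists>\<phi>. hom_on UNIV (prod_smodule (mid X1) (mid X2)) (pullback X1 X2) (mid Y) \<phi> \<and>
        \<phi> ` pullback X1 X2 = UNIV \<and>
        {u \<in> pullback X1 X2. \<phi> u = 0} = range (\<lambda>n. (inc X1 n, - inc X2 n)) \<and>
        (\<forall>n. inc Y n = \<phi> (inc X1 n, 0)) \<and>
        (\<forall>(x, y) \<in> pullback X1 X2. prj Y (\<phi> (x, y)) = prj X1 x))"

text \<open>\<open>Y\<close> is \<open>c \<cdot> X\<close>, the pushout of \<open>X\<close> along multiplication by \<open>c\<close> on \<open>N\<close>; such a morphism of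
  extensions determines \<open>Y\<close> up to equivalence.\<close>

definition is_scalar_multiple ::
  "'n::ab_group_add smodule \<Rightarrow> complex \<Rightarrow>
   ('e::ab_group_add, 'm, 'n) extension \<Rightarrow> ('f::ab_group_add, 'm, 'n) extension \<Rightarrow> bool" where
  "is_scalar_multiple N c X Y \<longleftrightarrow>
     (\<exists>\<phi>. smodule_hom (mid X) (mid Y) \<phi> \<and>
        (\<forall>n. \<phi> (inc X n) = inc Y (scl N c n)) \<and> (\<forall>x. prj Y (\<phi> x) = prj X x))"

text \<open>Every middle term is, as a vector space, isomorphic to \<open>M \<oplus> N\<close>, so it can be taken on the
  type \<open>'m \<times> 'n\<close>; no representative is lost, as shown by \<open>extension_on_product\<close> below. Note that the
  scalar multiplication, the action and the two maps remain arbitrary.\<close>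

definition extensions ::
  "'m::ab_group_add smodule \<Rightarrow> 'n::ab_group_add smodule \<Rightarrow> ('m \<times> 'n, 'm, 'n) extension set" where
  "extensions M N = {X. is_extension M N X}"

type_synonym ('m, 'n) ext_class = "('m \<times> 'n, 'm, 'n) extension set"

definition Ext1 ::
  "'m::ab_group_add smodule \<Rightarrow> 'n::ab_group_add smodule \<Rightarrow> ('m, 'n) ext_class set" where
  "Ext1 M N = extensions M N // {(X, Y). X \<in> extensions M N \<and> Y \<in> extensions M N \<and> ext_equiv X Y}"

definition ext_add ::
  "'m::ab_group_add smodule \<Rightarrow> 'n::ab_group_add smodule \<Rightarrow>
   ('m, 'n) ext_class \<Rightarrow> ('m, 'n) ext_class \<Rightarrow> ('m, 'n) ext_class" where
  "ext_add M N \<xi> \<eta> = {Y \<in> extensions M N. \<exists>X1\<in>\<xi>. \<exists>X2\<in>\<eta>. is_baer_sum X1 X2 Y}"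

definition ext_scale ::
  "'m::ab_group_add smodule \<Rightarrow> 'n::ab_group_add smodule \<Rightarrow>
   complex \<Rightarrow> ('m, 'n) ext_class \<Rightarrow> ('m, 'n) ext_class" where
  "ext_scale M N c \<xi> = {Y \<in> extensions M N. \<exists>X\<in>\<xi>. is_scalar_multiple N c X Y}"

lemma extension_on_product:
  fixes M :: "'m::ab_group_add smodule" and N :: "'n::ab_group_add smodule"
    and X :: "('e::ab_group_add, 'm, 'n) extension"
  assumes M: "is_smodule M" and N: "is_smodule N" and X: "is_extension M N X"
  shows "\<exists>Y \<in> extensions M N. ext_equiv X Y"
proof -
  define E where "E = mid X"
  define i where "i = inc X"
  define p where "p = prj X"
  have vs: "vector_space (scl M)" "vector_space (scl N)" "vector_space (scl E)"
    using assms by (auto simp: is_smodule_def is_extension_def E_def)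
  have E: "is_smodule E" and i: "smodule_hom N E i" "inj i" and p: "smodule_hom E M p" "surj p"
    and ex: "range i = {x. p x = 0}"
    using X by (auto simp: is_extension_def E_def i_def p_def)
  interpret EM: vector_space_pair "scl E" "scl M" using vs by (simp add: vector_space_pair_def)
  have linp: "Vector_Spaces.linear (scl E) (scl M) p"
    using p vs by (auto simp: Vector_Spaces.linear_iff hom_on_def)
  have lini: "Vector_Spaces.linear (scl N) (scl E) i"
    using i vs by (auto simp: Vector_Spaces.linear_iff hom_on_def)
  obtain s where s: "Vector_Spaces.linear (scl M) (scl E) s" and ps: "p \<circ> s = id"
    using EM.linear_surjective_right_inverse[OF linp p(2)] by auto
  interpret s: Vector_Spaces.linear "scl M" "scl E" s by fact
  interpret p: Vector_Spaces.linear "scl E" "scl M" p by fact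
  interpret i: Vector_Spaces.linear "scl N" "scl E" i by fact
  have ps': "p (s m) = m" for m using ps by (metis comp_apply id_apply)
  have pi: "p (i n) = 0" for n using ex by auto
  define t where "t = (\<lambda>(m, n). s m + i n)"
  define t' where "t' = (\<lambda>x. (p x, inv i (x - s (p x))))"
  have ii: "i (inv i (x - s (p x))) = x - s (p x)" for x
  proof -
    have "p (x - s (p x)) = 0" by (simp add: p.diff ps')
    hence "x - s (p x) \<in> range i" using ex by blast
    thus ?thesis by (rule f_inv_into_f)
  qed
  have tt': "t (t' x) = x" for x by (simp add: t_def t'_def ii)
  have t't: "t' (t u) = u" for u
    using i(2) by (cases u) (simp add: t_def t'_def p.add ps' pi)
  have tadd: "t (u + v) = t u + t v" for u v
    by (cases u; cases v) (simp add: t_def s.add i.add algebra_simps)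
  have t'add: "t' (x + y) = t' x + t' y" for x y by (metis tadd tt' t't)
  define Y where "Y = \<lparr>mid = \<lparr>scl = (\<lambda>c u. t' (scl E c (t u))), act = (\<lambda>a u. t' (act E a (t u)))\<rparr>,
      inc = (\<lambda>n. t' (i n)), prj = (\<lambda>u. p (t u))\<rparr>"
  have vE: "scl E c (x + y) = scl E c x + scl E c y" "scl E (c + d) x = scl E c x + scl E d x"
    "scl E c (scl E d x) = scl E (c * d) x" "scl E 1 x = x" for c d x y
    using vs(3) by (auto simp: vector_space_def)
  have vsY: "vector_space (scl (mid Y))"
    by (simp add: vector_space_def Y_def tt' t't tadd t'add vE)
  have aE: "Vector_Spaces.linear (scl E) (scl E) (act E a)"
      "Vector_Spaces.linear (*s) (scl E) (\<lambda>a. act E a v)"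
      "act E (bracket a b) v = act E a (act E b v) - act E b (act E a v)" for a b v
    using E by (auto simp: is_smodule_def)
  have addE: "act E a (x + y) = act E a x + act E a y" "act E a (scl E c x) = scl E c (act E a x)"
    "act E (a + b) x = act E a x + act E b x" "act E (c *s a) x = scl E c (act E a x)" for a b c x y
    using aE(1,2) by (auto simp: Vector_Spaces.linear_iff)
  have t'diff: "t' (x - y) = t' x - t' y" for x y by (metis t'add diff_add_cancel add_diff_cancel)
  have "is_smodule (mid Y)"
    unfolding is_smodule_def
  proof (intro conjI allI)
    show "vector_space (scl (mid Y))" by fact
    fix a b v
    show "Vector_Spaces.linear (scl (mid Y)) (scl (mid Y)) (act (mid Y) a)"
unfolding Vector_Spaces.linear_iff
      by (intro conjI allI vsY vec.vector_space_axioms) (simp_all add: Y_def tt' tadd t'add addE)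
    show "Vector_Spaces.linear (*s) (scl (mid Y)) (\<lambda>a. act (mid Y) a v)"
      unfolding Vector_Spaces.linear_iff
      by (intro conjI allI vsY vec.vector_space_axioms) (simp_all add: Y_def tt' tadd t'add addE)
    show "act (mid Y) (bracket a b) v =
        act (mid Y) a (act (mid Y) b v) - act (mid Y) b (act (mid Y) a v)"
      by (simp add: Y_def tt' aE(3) t'diff)
  qed
  moreover have "smodule_hom N (mid Y) (inc Y)" "smodule_hom (mid Y) M (prj Y)"
    using i(1) p(1) by (auto simp: hom_on_def Y_def tt' tadd t'add)
  moreover have "inj (inc Y)"
    proof (rule injI)
    fix n n' assume "inc Y n = inc Y n'"
    hence "t (t' (i n)) = t (t' (i n'))" by (simp add: Y_def)
    thus "n = n'" using i(2) by (simp add: tt' inj_eq)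
  qed
  moreover have "surj (prj Y)"
    by (rule surjI[of _ "\<lambda>m. t' (s m)"]) (simp add: Y_def tt' ps')
  moreover have "range (inc Y) = {u. prj Y u = 0}"
  proof (intro set_eqI iffI)
    fix u assume "u \<in> {u. prj Y u = 0}"
    hence "p (t u) = 0" by (simp add: Y_def)
    then obtain n where "t u = i n" using ex by blast
    hence "t' (t u) = inc Y n" by (simp add: Y_def)
    hence "u = inc Y n" by (simp only: t't)
    thus "u \<in> range (inc Y)" by blast
  qed (auto simp: Y_def tt' pi)
  ultimately have "Y \<in> extensions M N" by (simp add: extensions_def is_extension_def)
  moreover have "ext_equiv X Y"
    unfolding ext_equiv_def
  proof (intro exI[of _ t'] conjI allI)
    show "bij t'" by (rule o_bij[of t]) (auto simp: tt' t't)
  qed (auto simp: hom_on_def Y_def tt' t'add E_def i_def p_def)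
  ultimately show ?thesis by blast
qed

text \<open>A complex vector space \<open>(S, add, smul)\<close> isomorphic to the complex line; its axioms follow by
  transport along the bijection.\<close>

definition isomorphic_to_complex_line ::
  "'a set \<Rightarrow> ('a \<Rightarrow> 'a \<Rightarrow> 'a) \<Rightarrow> (complex \<Rightarrow> 'a \<Rightarrow> 'a) \<Rightarrow> bool" where
  "isomorphic_to_complex_line S add smul \<longleftrightarrow>
     (\<forall>x\<in>S. \<forall>y\<in>S. add x y \<in> S) \<and> (\<forall>c. \<forall>x\<in>S. smul c x \<in> S) \<and>
     (\<exists>\<Phi>. bij_betw \<Phi> S (UNIV :: complex set) \<and>
        (\<forall>x\<in>S. \<forall>y\<in>S. \<Phi> (add x y) = \<Phi> x + \<Phi> y) \<and>
        (\<forall>c. \<forall>x\<in>S. \<Phi> (smul c x) = c * \<Phi> x))"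

end

theory Submission
  imports Defs "HOL-Computational_Algebra.Fundamental_Theorem_Algebra"
begin

text \<open>On vectors \<open>w\<close> with \<open>e w = 0\<close>, \<open>h w = k w\<close> the operators \<open>p\<close> and \<open>D w = k q w - p f w\<close> shift
  the highest weight \<open>k\<close> by \<open>1\<close> and \<open>-1\<close>, and \<open>D p - p D = - (k + 1) z\<close>. A highest weight vector \<open>v\<close>
  of minimal weight \<open>n\<close> in \<open>V\<close> is killed by \<open>D\<close>, so \<open>V\<close> is spanned by the vectors \<open>f\<^sup>i p\<^sup>j v\<close>, and these
  are separated by the eigenvalues of the Casimir element and of \<open>h\<close>. Hence \<open>z\<close> acts by a scalar \<open>c\<close>,
  and \<open>c \<noteq> 0\<close>, since otherwise \<open>p v\<close> generates a proper submodule and \<open>V\<close> is finite-dimensional.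

  Given a self-extension \<open>\<iota> : V \<rightarrow> E\<close>, \<open>\<pi> : E \<rightarrow> V\<close>, the vector \<open>v\<close> lifts to a vector of the same kind, and
  \<open>z - c = b (\<iota> \<circ> \<pi>)\<close> on \<open>E\<close> for a unique scalar \<open>b\<close>. Two extensions with the same \<open>b\<close> are equivalent: the
  submodule of their product generated by the lifts of \<open>v\<close> and by the copies of \<open>v\<close> is the graph of an
  isomorphism. The derivation \<open>p \<mapsto> p\<close>, \<open>q \<mapsto> q\<close>, \<open>z \<mapsto> 2 z\<close> of the Lie algebra yields an extension for
  every value of \<open>b\<close>, and \<open>b\<close> is additive and homogeneous.\<close>

section \<open>Submodules generated by vectors of lowest type\<close>

text \<open>The Casimir element of \<open>sl2\<close> plus \<open>\<i> h\<close>. The real part of an eigenvalue on \<open>f\<^sup>i p\<^sup>j v\<close> determines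
  \<open>j\<close>, and the imaginary part then determines \<open>i\<close>.\<close>

definition casimir_h :: "'v::ab_group_add smodule \<Rightarrow> 'v \<Rightarrow> 'v" where
  "casimir_h M x = scl M 4 (act M b_f (act M b_e x)) + act M b_h (act M b_h x) + scl M (2 + \<i>) (act M b_h x)"

text \<open>For a highest weight vector \<open>x\<close> of weight \<open>k\<close>, this is the
  combination of \<open>q x\<close> and \<open>p f x\<close> that \<open>e\<close> annihilates. It
  has weight \<open>k - 1\<close>, just as \<open>p x\<close> has weight
  \<open>k + 1\<close>.\<close>

definition lowering :: "'v::ab_group_add smodule \<Rightarrow> complex \<Rightarrow> 'v \<Rightarrow> 'v" where
  "lowering M k x = scl M k (act M b_q x) - act M b_p (act M b_f x)"

definition primitive :: "'v::ab_group_add smodule \<Rightarrow> complex \<Rightarrow> 'v \<Rightarrow> bool" where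
  "primitive M k x \<longleftrightarrow> act M b_e x = 0 \<and> act M b_h x = scl M k x"

definition lowest :: "'v::ab_group_add smodule \<Rightarrow> nat \<Rightarrow> 'v \<Rightarrow> bool" where
  "lowest M n x \<longleftrightarrow> primitive M (of_nat n) x \<and> (act M b_f ^^ Suc n) x = 0 \<and> lowering M (of_nat n) x = 0"

definition fp :: "'v::ab_group_add smodule \<Rightarrow> nat \<Rightarrow> nat \<Rightarrow> 'v \<Rightarrow> 'v" where
  "fp M i j x = (act M b_f ^^ i) ((act M b_p ^^ j) x)"

definition fp_eigenvalue :: "nat \<Rightarrow> nat \<Rightarrow> nat \<Rightarrow> complex" where
  "fp_eigenvalue n i j = of_nat ((n + j) * (n + j + 2)) + \<i> * (of_nat (n + j) - 2 * of_nat i)"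

text \<open>For \<open>Y\<close> consisting of lowest vectors the bound on \<open>i\<close> omits
  only zero vectors. It also keeps the eigenvalue belonging to \<open>f^(n+1) y\<close> off the list
  of eigenvalues, which the lifting argument uses.\<close>

definition gens :: "'v::ab_group_add smodule \<Rightarrow> nat \<Rightarrow> 'v set \<Rightarrow> 'v set" where
  "gens M n Y = {fp M i j y | i j y. i \<le> n + j \<and> y \<in> Y}"

section \<open>Modules over the Schroedinger algebra and their commutation relations\<close>

locale schr_module =
  fixes M :: "'v::ab_group_add smodule"
  assumes is_smodule: "is_smodule M"
begin

sublocale vector_space "scl M" using is_smodule by (simp add: is_smodule_def)

abbreviation "sc \<equiv> scl M"
abbreviation "E \<equiv> act M b_e"
abbreviation "H \<equiv> act M b_h"
abbreviation "F \<equiv> act M b_f"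
abbreviation "P \<equiv> act M b_p"
abbreviation "Q \<equiv> act M b_q"
abbreviation "Z \<equiv> act M b_z"
abbreviation "T \<equiv> casimir_h M"

lemma act_add: "act M a (x + y) = act M a x + act M a y"
  and act_scale: "act M a (sc c x) = sc c (act M a x)"
  and act_add_left: "act M (a + b) x = act M a x + act M b x"
  and act_scale_left: "act M (c *s a) x = sc c (act M a x)"
  using is_smodule by (auto simp: is_smodule_def Vector_Spaces.linear_iff)

lemma linear_act: "Vector_Spaces.linear sc sc (act M a)"
  using is_smodule by (auto simp: is_smodule_def)

lemma act_zero [simp]: "act M a 0 = 0"
  by (metis act_add add_cancel_right_right)

lemma act_diff: "act M a (x - y) = act M a x - act M a y"
  by (metis act_add diff_add_cancel add_diff_cancel)

lemma act_minus: "act M a (- x) = - act M a x"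
  by (metis act_diff act_zero diff_0)

lemma act_zero_left [simp]: "act M 0 x = 0"
  by (metis act_add_left add_cancel_right_right)

lemma act_diff_left: "act M (a - b) x = act M a x - act M b x"
  by (metis act_add_left diff_add_cancel add_diff_cancel)

lemma act_minus_left: "act M (- b) x = - act M b x"
  by (metis act_diff_left act_zero_left diff_0)

lemmas act_linear = act_add act_scale act_diff act_minus

lemma act_commute: "act M a (act M b x) = act M b (act M a x) + act M (bracket a b) x"
  using is_smodule by (simp add: is_smodule_def)

lemma HE: "H (E x) = E (H x) + sc 2 (E x)"
  by (rule trans[OF act_commute], simp add: bracket_basis act_scale_left act_minus_left)

lemma EF: "E (F x) = F (E x) + H x"
  by (rule trans[OF act_commute], simp add: bracket_basis act_scale_left act_minus_left)

lemma HF: "H (F x) = F (H x) - sc 2 (F x)"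
  by (rule trans[OF act_commute], simp add: bracket_basis act_scale_left act_minus_left)

lemma HP: "H (P x) = P (H x) + P x"
  by (rule trans[OF act_commute], simp add: bracket_basis act_scale_left act_minus_left)

lemma HQ: "H (Q x) = Q (H x) - Q x"
  by (rule trans[OF act_commute], simp add: bracket_basis act_scale_left act_minus_left)

lemma EP: "E (P x) = P (E x)"
  by (rule trans[OF act_commute], simp add: bracket_basis act_scale_left act_minus_left)

lemma EQ: "E (Q x) = Q (E x) + P x"
  by (rule trans[OF act_commute], simp add: bracket_basis act_scale_left act_minus_left)

lemma FP: "F (P x) = P (F x) + Q x"
  by (rule trans[OF act_commute], simp add: bracket_basis act_scale_left act_minus_left)

lemma FQ: "F (Q x) = Q (F x)"
  by (rule trans[OF act_commute], simp add: bracket_basis act_scale_left act_minus_left)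

lemma PQ: "P (Q x) = Q (P x) + Z x"
  by (rule trans[OF act_commute], simp add: bracket_basis act_scale_left act_minus_left)

lemma EZ: "E (Z x) = Z (E x)"
  by (rule trans[OF act_commute], simp add: bracket_basis act_scale_left act_minus_left)

lemma HZ: "H (Z x) = Z (H x)"
  by (rule trans[OF act_commute], simp add: bracket_basis act_scale_left act_minus_left)

lemma FZ: "F (Z x) = Z (F x)"
  by (rule trans[OF act_commute], simp add: bracket_basis act_scale_left act_minus_left)

lemma PZ: "P (Z x) = Z (P x)"
  by (rule trans[OF act_commute], simp add: bracket_basis act_scale_left act_minus_left)

lemma QZ: "Q (Z x) = Z (Q x)"
  by (rule trans[OF act_commute], simp add: bracket_basis act_scale_left act_minus_left)

lemma schr_expand: "(a :: schr) = a $ Be *s b_e + a $ Bh *s b_h + a $ Bf *s b_f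
    + a $ Bp *s b_p + a $ Bq *s b_q + a $ Bz *s b_z"
  unfolding vec_eq_iff
proof
  fix i show "a $ i = (a $ Be *s b_e + a $ Bh *s b_h + a $ Bf *s b_f
    + a $ Bp *s b_p + a $ Bq *s b_q + a $ Bz *s b_z) $ i"
    by (cases i) (simp_all add: axis_def)
qed

lemma act_expand: "act M a x = sc (a $ Be) (E x) + sc (a $ Bh) (H x) + sc (a $ Bf) (F x)
    + sc (a $ Bp) (P x) + sc (a $ Bq) (Q x) + sc (a $ Bz) (Z x)"
  by (subst schr_expand[of a]) (simp add: act_add_left act_scale_left)

lemma submoduleI:
  assumes "subspace W"
    and "\<And>x. x \<in> W \<Longrightarrow> E x \<in> W" "\<And>x. x \<in> W \<Longrightarrow> H x \<in> W" "\<And>x. x \<in> W \<Longrightarrow> F x \<in> W"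
    and "\<And>x. x \<in> W \<Longrightarrow> P x \<in> W" "\<And>x. x \<in> W \<Longrightarrow> Q x \<in> W" "\<And>x. x \<in> W \<Longrightarrow> Z x \<in> W"
  shows "submodule UNIV M W"
  unfolding submodule_def
proof (intro conjI ballI assms(1))
  fix a x assume "x \<in> W"
  then show "act M a x \<in> W"
    unfolding act_expand[of a] by (intro subspace_add subspace_scale assms)
qed

lemma act_Z_commute: "act M a (Z x) = Z (act M a x)"
  unfolding act_expand[of a] by (simp add: act_linear EZ HZ FZ PZ QZ)

lemma funpow_add: "(act M a ^^ i) (x + y) = (act M a ^^ i) x + (act M a ^^ i) y"
  by (induction i) (simp_all add: act_add)

lemma funpow_scale: "(act M a ^^ i) (sc c x) = sc c ((act M a ^^ i) x)"
  by (induction i) (simp_all add: act_scale)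

lemma funpow_zero [simp]: "(act M a ^^ i) 0 = 0"
  by (induction i) simp_all

lemma funpow_minus: "(act M a ^^ i) (- x) = - (act M a ^^ i) x"
  by (induction i) (simp_all add: act_minus)

lemma funpow_diff: "(act M a ^^ i) (x - y) = (act M a ^^ i) x - (act M a ^^ i) y"
  by (induction i) (simp_all add: act_diff)

lemmas funpow_linear = funpow_add funpow_scale funpow_diff funpow_minus

lemma funpow_Z: "(act M a ^^ i) (Z x) = Z ((act M a ^^ i) x)"
  by (induction i) (simp_all add: act_Z_commute)

lemma fp_Z: "fp M i j (Z x) = Z (fp M i j x)"
  by (simp add: fp_def funpow_Z)

lemma scale_2: "sc 2 x = x + x"
  using scale_left_distrib[of 1 1 x] by simp

section \<open>Powers of \<open>f\<close> and the other basis operators\<close>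

lemma H_funpow_F: "H ((F ^^ i) x) = (F ^^ i) (H x) - sc (2 * of_nat i) ((F ^^ i) x)"
proof (induction i)
  case (Suc i)
  show ?case
    by (simp only: funpow.simps o_apply HF Suc.IH) (simp add: act_linear scale_2 algebra_simps)
qed simp

lemma E_funpow_F:
  "E ((F ^^ Suc i) x) = (F ^^ Suc i) (E x) + sc (of_nat (Suc i)) ((F ^^ i) (H x - sc (of_nat i) x))"
proof (induction i)
  case 0 then show ?case by (simp add: EF)
next
  case (Suc i)
  have "E ((F ^^ Suc (Suc i)) x) = F (E ((F ^^ Suc i) x)) + H ((F ^^ Suc i) x)"
    by (simp add: EF)
  also have "\<dots> = (F ^^ Suc (Suc i)) (E x) + sc (of_nat (Suc (Suc i))) ((F ^^ Suc i) (H x - sc (of_nat (Suc i)) x))"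
    unfolding Suc.IH H_funpow_F by (simp add: funpow_linear act_linear algebra_simps scale_2)
  finally show ?case .
qed

lemma Q_funpow_F: "Q ((F ^^ i) x) = (F ^^ i) (Q x)"
  by (induction i) (simp_all flip: FQ)

text \<open>The commutator of \<open>f\<close> and \<open>p\<close> is \<open>q\<close>, which
  commutes with \<open>f\<close>; so each of the \<open>Suc i\<close> factors \<open>f\<close>
  contributes the same term.\<close>

lemma P_funpow_F:
  "P ((F ^^ Suc i) x) = (F ^^ Suc i) (P x) - sc (of_nat (Suc i)) ((F ^^ i) (Q x))"
proof (induction i)
  case 0 then show ?case by (simp add: FP)
next
  case (Suc i)
  have "P ((F ^^ Suc (Suc i)) x) = F (P ((F ^^ Suc i) x)) - (F ^^ Suc i) (Q x)"
    using FP[of "(F ^^ Suc i) x"] by (simp add: Q_funpow_F FQ[symmetric])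
  also have "\<dots> = (F ^^ Suc (Suc i)) (P x) - sc (of_nat (Suc (Suc i))) ((F ^^ Suc i) (Q x))"
    unfolding Suc.IH by (simp add: funpow_linear act_linear algebra_simps scale_2)
  finally show ?case .
qed

section \<open>Highest weight vectors under \<open>p\<close> and \<open>lowering\<close>\<close>

lemma primitive_P: "primitive M k x \<Longrightarrow> primitive M (k + 1) (P x)"
  by (simp add: primitive_def EP HP act_linear algebra_simps)

lemma primitive_funpow_P: "primitive M k x \<Longrightarrow> primitive M (k + of_nat j) ((P ^^ j) x)"
  by (induction j) (auto dest: primitive_P simp: algebra_simps)

text \<open>Both \<open>e (k q x)\<close> and \<open>e (p f x)\<close> equal \<open>k p x\<close>,
  so they cancel.\<close>

lemma primitive_lowering: 
  assumes "primitive M k x"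
  shows "primitive M (k - 1) (lowering M k x)"
  using assms EF[of x] by (simp add: primitive_def lowering_def EQ HQ HP HF EP act_linear algebra_simps scale_2)

lemma lowering_P:
  assumes "primitive M k x"
  shows "lowering M (k + 1) (P x) = P (lowering M k x) - sc (k + 1) (Z x)"
  by (simp add: lowering_def FP PQ act_linear algebra_simps)

text \<open>\<open>lowering\<close> kills \<open>x\<close>, so moving it past the factors
  \<open>p\<close> leaves only the central commutator terms from \<open>lowering_P\<close>. Their
  sum has the form \<open>d p^j z x\<close>, which is what closure of the generated span under
  \<open>q\<close> requires.\<close>

lemma lowering_funpow_P:
  assumes "lowest M n x"
  shows "\<exists>d. lowering M (of_nat (n + Suc j)) ((P ^^ Suc j) x) = sc d ((P ^^ j) (Z x))"
proof (induction j)
  case 0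
  then show ?case using assms lowering_P[of "of_nat n" x] 
    by (auto simp: lowest_def add.commute simp flip: scale_minus_left)
next
  case (Suc j)
  then obtain d where d: "lowering M (of_nat (n + Suc j)) ((P ^^ Suc j) x) = sc d ((P ^^ j) (Z x))" by blast
  have "primitive M (of_nat (n + Suc j)) ((P ^^ Suc j) x)"
    using primitive_funpow_P[of "of_nat n" x "Suc j"] assms by (simp add: lowest_def add_ac)
  from lowering_P[OF this] d
  have "lowering M (of_nat (n + Suc (Suc j))) ((P ^^ Suc (Suc j)) x)
     = sc (d - (of_nat (n + Suc j) + 1)) ((P ^^ Suc j) (Z x))"
    by (simp add: act_linear funpow_Z algebra_simps PZ)
  then show ?case by blast
qed

text \<open>Moving one \<open>p\<close> to the left of \<open>f^(n+j+2)\<close> produces a term with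
  \<open>q\<close>. As \<open>q\<close> commutes with \<open>f\<close>, both terms contain the
  vector that vanishes by induction.\<close>

lemma funpow_F_P:
  assumes "lowest M n x"
  shows "(F ^^ Suc (n + j)) ((P ^^ j) x) = 0"
proof (induction j)
  case 0 then show ?case using assms by (simp add: lowest_def)
next
  case (Suc j)
  have "(F ^^ Suc (Suc (n + j))) (P ((P ^^ j) x)) = P ((F ^^ Suc (Suc (n + j))) ((P ^^ j) x)) + sc (of_nat (Suc (Suc (n + j)))) ((F ^^ Suc (n + j)) (Q ((P ^^ j) x)))"
    by (subst P_funpow_F) simp
  also have "\<dots> = 0" using Suc.IH unfolding Q_funpow_F[symmetric] by simp
  finally show ?case by simp
qed

lemma fp_eq_0: "lowest M n x \<Longrightarrow> i > n + j \<Longrightarrow> fp M i j x = 0"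
proof -
  assume a: "lowest M n x" "i > n + j"
  then obtain k where "i = k + Suc (n + j)" by (metis add.commute less_imp_Suc_add add_Suc_right)
  then show ?thesis using funpow_F_P[OF a(1), of j] unfolding fp_def by (simp only: Nat.funpow_add o_apply funpow_zero)
qed

section \<open>The action of \<open>sl2\<close> on the vectors \<open>f^i p^j x\<close>\<close>

lemma H_fp: "lowest M n x \<Longrightarrow> H (fp M i j x) = sc (of_nat (n + j) - 2 * of_nat i) (fp M i j x)"
  using primitive_funpow_P[of "of_nat n" x j]
  by (simp add: lowest_def primitive_def fp_def H_funpow_F funpow_linear algebra_simps)

lemma E_fp_0: "lowest M n x \<Longrightarrow> E (fp M 0 j x) = 0"
  using primitive_funpow_P[of "of_nat n" x j]
  by (simp add: lowest_def primitive_def fp_def)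

lemma E_fp_Suc: "lowest M n x \<Longrightarrow>
  E (fp M (Suc i) j x) = sc (of_nat (Suc i) * (of_nat (n + j) - of_nat i)) (fp M i j x)"
  using primitive_funpow_P[of "of_nat n" x j] unfolding fp_def E_funpow_F
  by (simp add: lowest_def primitive_def funpow_linear algebra_simps)

lemma F_fp: "F (fp M i j x) = fp M (Suc i) j x"
  by (simp add: fp_def)

lemma T_fp:
  assumes "lowest M n x"
  shows "T (fp M i j x) = sc (fp_eigenvalue n i j) (fp M i j x)"
proof (cases i)
  case 0
  then show ?thesis using assms
    by (simp add: casimir_h_def E_fp_0 H_fp act_linear fp_eigenvalue_def flip: scale_left_distrib)
      (simp add: algebra_simps)
next
  case (Suc i')
  then show ?thesis using assms
    by (simp add: casimir_h_def E_fp_Suc H_fp F_fp act_linear fp_eigenvalue_def flip: scale_left_distrib)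
      (simp add: algebra_simps)
qed

text \<open>This eliminates \<open>q\<close> in favour of \<open>lowering\<close> and
  \<open>f p\<close>; for natural weights \<open>k\<close> the factor \<open>k + 1\<close> is
  invertible.\<close>

lemma Q_primitive: "primitive M k w \<Longrightarrow> sc (k + 1) (Q w) = lowering M k w + F (P w)"
  by (simp add: lowering_def FP algebra_simps)

section \<open>The submodule generated by a space of lowest vectors\<close>

definition gen where "gen n Y = span (gens M n Y)"

lemma fp_in_gen: "y \<in> Y \<Longrightarrow> lowest M n y \<Longrightarrow> fp M i j y \<in> gen n Y"
  by (cases "i \<le> n + j") (auto simp: gen_def gens_def fp_eq_0 intro: span_base span_zero)

lemma subset_gen: "Y \<subseteq> gen n Y"
proof
  fix y assume "y \<in> Y"
  then have "fp M 0 0 y \<in> gens M n Y" by (auto simp: gens_def)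
  then show "y \<in> gen n Y" by (auto simp: gen_def fp_def intro: span_base)
qed

lemma Q_primitive_funpow:
  assumes "lowest M n x"
  shows "(F ^^ i) (Q ((P ^^ j) x)) = sc (1 / (of_nat (n + j) + 1)) ((F ^^ i) (lowering M (of_nat (n + j)) ((P ^^ j) x)) + fp M (Suc i) (Suc j) x)"
proof -
  let ?w = "(P ^^ j) x" let ?k = "of_nat (n + j) :: complex"
  have k: "?k + 1 \<noteq> 0" by (metis of_nat_Suc of_nat_neq_0 add.commute)
  have "sc (?k + 1) (Q ?w) = lowering M ?k ?w + F (P ?w)"
    using Q_primitive[of ?k ?w] primitive_funpow_P[of "of_nat n" x j] assms by (simp add: lowest_def)
  then have "Q ?w = sc (1 / (?k + 1)) (lowering M ?k ?w + F (P ?w))"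
    by (metis (no_types, lifting) k scale_scale scale_one nonzero_divide_eq_eq)
  then show ?thesis by (simp add: funpow_linear fp_def funpow_swap1)
qed

text \<open>Closure under \<open>e\<close>, \<open>h\<close>, \<open>f\<close> is
  \<open>sl2\<close>-theory, and closure under \<open>z\<close> comes from \<open>Y\<close>. For
  \<open>p\<close> and \<open>q\<close> one commutes past the powers of \<open>f\<close> and
  rewrites \<open>q p^j y\<close> by \<open>Q_primitive\<close>; the resulting
  \<open>lowering\<close> term is a multiple of \<open>p^(j-1) z y\<close>, or zero for
  \<open>j = 0\<close>.\<close>

lemma gen_submodule:
  assumes Y: "subspace Y" "\<And>y. y \<in> Y \<Longrightarrow> lowest M n y" "\<And>y. y \<in> Y \<Longrightarrow> Z y \<in> Y"
  shows "submodule UNIV M (gen n Y)"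
proof -
  have fpg: "fp M i j y \<in> gen n Y" if "y \<in> Y" for i j y using fp_in_gen that Y by blast
  note clos = subspace_add[OF subspace_span, of _ "gens M n Y", folded gen_def]
     subspace_scale[OF subspace_span, of _ "gens M n Y", folded gen_def]
     subspace_diff[OF subspace_span, of _ "gens M n Y", folded gen_def]
  have lw: "(F ^^ i) (lowering M (of_nat (n + j)) ((P ^^ j) y)) \<in> gen n Y" if y: "y \<in> Y" for i j y
  proof (cases j)
    case 0 then show ?thesis using Y(2)[OF y] by (simp add: lowest_def gen_def span_zero)
  next
    case (Suc j')
    then show ?thesis using lowering_funpow_P[OF Y(2)[OF y], of j'] fpg[OF Y(3)[OF y], of i j']
      by (auto simp: funpow_linear fp_def intro: clos)
  qed
  have q: "(F ^^ i) (Q ((P ^^ j) y)) \<in> gen n Y" if y: "y \<in> Y" for i j y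
    unfolding Q_primitive_funpow[OF Y(2)[OF y]] by (intro clos lw fpg y)
  have ext: "act M a x \<in> gen n Y" if "x \<in> gen n Y" "\<And>i j y. y \<in> Y \<Longrightarrow> act M a (fp M i j y) \<in> gen n Y" for a x
    using that(1) unfolding gen_def
  proof (induction rule: span_induct_alt)
    case base then show ?case by (simp add: span_zero)
  next
    case (step c x y)
    then show ?case using that(2) unfolding act_linear gen_def[symmetric] by (auto simp: gens_def intro!: clos)
  qed
  show ?thesis
  proof (rule submoduleI)
    show "subspace (gen n Y)" by (simp add: gen_def)
    fix x assume x: "x \<in> gen n Y"
    show "E x \<in> gen n Y"
    proof (rule ext[OF x])
      fix i j y assume "y \<in> Y"
      then show "E (fp M i j y) \<in> gen n Y"
        by (cases i) (auto simp: E_fp_0[OF Y(2)] E_fp_Suc[OF Y(2)] fpg gen_def[symmetric] intro: clos span_zero[of "gens M n Y", folded gen_def])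
    qed
    show "H x \<in> gen n Y" by (rule ext[OF x]) (auto simp: H_fp[OF Y(2)] intro!: clos fpg)
    show "F x \<in> gen n Y" by (rule ext[OF x]) (auto simp: F_fp Y intro!: clos fpg)
    show "Z x \<in> gen n Y" by (rule ext[OF x]) (auto simp: fp_Z[symmetric] Y intro!: clos fpg)
    show "Q x \<in> gen n Y" by (rule ext[OF x]) (auto simp: fp_def Q_funpow_F intro!: q)
    show "P x \<in> gen n Y"
    proof (rule ext[OF x])
      fix i j y assume y: "y \<in> Y"
      show "P (fp M i j y) \<in> gen n Y"
      proof (cases i)
        case 0 then show ?thesis using fpg[OF y, of 0 "Suc j"] by (simp add: fp_def)
      next
        case (Suc i')
        have "(F ^^ i) (P ((P ^^ j) y)) \<in> gen n Y" using fpg[OF y, of i "Suc j"] by (simp add: fp_def)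
        then show ?thesis unfolding fp_def Suc P_funpow_F by (intro clos q y)
      qed
    qed
  qed
qed

end

section \<open>Eigenvectors\<close>

context vector_space
begin

lemma eigenvectors_sum_zero:
  assumes T: "Vector_Spaces.linear scale scale T" and "finite I" "inj_on l I"
    and "\<And>i. i \<in> I \<Longrightarrow> T (x i) = scale (l i) (x i)" "(\<Sum>i\<in>I. x i) = 0" "i \<in> I"
  shows "x i = 0"
  using assms(2-)
proof (induction I arbitrary: x i)
  case empty then show ?case by simp
next
  case (insert m I)
  interpret T: Vector_Spaces.linear scale scale T by fact
  have s: "x m + sum x I = 0" using insert by simp
  \<comment> \<open>Applying \<open>T - l m\<close> removes the summand \<open>x m\<close> and
    multiplies every other summand by a nonzero scalar.\<close>
  have "T (x m + sum x I) - scale (l m) (x m + sum x I) = (\<Sum>i\<in>I. scale (l i - l m) (x i))"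
    using insert.prems(2)
    by (simp add: T.add T.sum scale_right_distrib scale_sum_right scale_left_diff_distrib sum_subtractf)
  then have "(\<Sum>i\<in>I. scale (l i - l m) (x i)) = 0" by (simp add: s T.zero)
  moreover have "T (scale (l i - l m) (x i)) = scale (l i) (scale (l i - l m) (x i))" if "i \<in> I" for i
    unfolding T.scale insert.prems(2)[OF insertI2[OF that]] by (simp add: mult.commute)
  moreover have "inj_on l I" using insert.prems(1) by simp
  ultimately have "scale (l i - l m) (x i) = 0" if "i \<in> I" for i
    using that by (intro insert.IH[of "\<lambda>i. scale (l i - l m) (x i)"])
  moreover have "l i \<noteq> l m" if "i \<in> I" for i
    by (metis that inj_onD[OF insert.prems(1)] insert.hyps(2) insertI1 insertI2)
  ultimately have x: "x i = 0" if "i \<in> I" for i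
    using that by (metis scale_eq_0_iff right_minus_eq)
  have "x m = 0" using s x by simp
  then show ?case using x insert.prems by auto
qed

lemma eigenvector_in_span:
  assumes T: "Vector_Spaces.linear scale scale T" and S: "\<And>s. s \<in> S \<Longrightarrow> \<exists>l. T s = scale l s"
    and w: "w \<in> span S" "T w = scale m w"
  shows "w \<in> span {s \<in> S. T s = scale m s}"
proof -
  interpret T: Vector_Spaces.linear scale scale T by fact
  obtain ev where ev: "\<And>s. s \<in> S \<Longrightarrow> T s = scale (ev s) s" using S by metis
  obtain t r where t: "finite t" "t \<subseteq> S" "w = (\<Sum>a\<in>t. scale (r a) a)"
    using w(1) unfolding span_explicit by blast
  define x where "x l = (\<Sum>a\<in>{a\<in>t. ev a = l}. scale (r a) a)" for l
  \<comment> \<open>The value \<open>m\<close> is inserted because it may fail to occur among the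
    eigenvalues on \<open>t\<close>; then \<open>x m\<close> is an empty sum and \<open>w\<close>
    turns out to be zero.\<close>
  define L where "L = insert m (ev ` t)"
  have fin: "finite L" using t by (simp add: L_def)
  have w_eq: "w = (\<Sum>l\<in>L. x l)"
    unfolding x_def t(3) by (rule sum.group[symmetric]) (use t fin in \<open>auto simp: L_def\<close>)
  have Tx: "T (x l) = scale l (x l)" for l
    using ev t(2) by (auto simp: x_def T.sum T.scale scale_sum_right mult.commute intro!: sum.cong)
  have "x m - (if m = m then w else 0) = 0"
  proof (rule eigenvectors_sum_zero[OF T fin, where l = id and x = "\<lambda>l. x l - (if l = m then w else 0)" and i = m])
    show "(\<Sum>l\<in>L. x l - (if l = m then w else 0)) = 0"
      using fin w_eq by (simp add: sum_subtractf L_def)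
  qed (auto simp: T.diff Tx w(2) L_def scale_right_diff_distrib T.zero)
  then have "w = x m" by simp
  also have "x m \<in> span {s \<in> S. T s = scale m s}"
    unfolding x_def using t ev by (intro span_sum span_scale span_base) auto
  finally show ?thesis .
qed

text \<open>On a span of eigenvectors \<open>T - m\<close> is diagonalizable, so the space is the
  sum of its image and its kernel. A generator with eigenvalue \<open>l\<close> different from
  \<open>m\<close> lies in the image, which gives the coefficient
  \<open>c / (l - m)\<close>.\<close>

lemma eigenspace_correction:
  assumes T: "Vector_Spaces.linear scale scale T" and S: "\<And>s. s \<in> S \<Longrightarrow> \<exists>l. T s = scale l s"
    and w: "w \<in> span S"
  shows "\<exists>y. y \<in> span S \<and> w - (T y - scale m y) \<in> span {s \<in> S. T s = scale m s}"
  using w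
proof (induction rule: span_induct_alt)
  case base
  interpret T: Vector_Spaces.linear scale scale T by fact
  show ?case by (intro exI[of _ 0]) (simp add: span_zero)
next
  case (step c s x)
  interpret T: Vector_Spaces.linear scale scale T by fact
  obtain y where y: "y \<in> span S" "x - (T y - scale m y) \<in> span {s \<in> S. T s = scale m s}"
    using step by blast
  obtain l where l: "T s = scale l s" using S step by blast
  show ?case
  proof (cases "l = m")
    case True
    then have "scale c s + (x - (T y - scale m y)) \<in> span {s \<in> S. T s = scale m s}"
      using step l y by (intro span_add span_scale) (auto intro: span_base)
    then show ?thesis using y by (auto intro!: exI[of _ y] simp: algebra_simps)
  next
    case False
    let ?y = "y + scale (c / (l - m)) s"
    have "T ?y - scale m ?y = (T y - scale m y) + scale (c / (l - m) * (l - m)) s"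
      by (simp only: T.add T.scale l)
        (simp add: algebra_simps diff_divide_distrib flip: scale_left_distrib)
    also have "c / (l - m) * (l - m) = c" using False by simp
    finally have "scale c s + x - (T ?y - scale m ?y) = x - (T y - scale m y)" by simp
    moreover have "?y \<in> span S" using y step by (intro span_add span_scale) (auto intro: span_base)
    ultimately show ?thesis using y(2) by metis
  qed
qed

text \<open>Otherwise the \<open>x i\<close> would be infinitely many eigenvectors with distinct
  eigenvalues, hence independent, inside a finite-dimensional space.\<close>

lemma eigensequence_reaches_zero:
  assumes T: "Vector_Spaces.linear scale scale T" and "finite B" "\<And>i. x i \<in> span B"
    and Tx: "\<And>i::nat. T (x i) = scale (l i) (x i)" and "inj l"
  shows "\<exists>i. x i = 0"
proof (rule ccontr)
  assume nz: "\<nexists>i. x i = 0"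
  have injx: "inj x"
  proof (rule injI)
    fix i j assume "x i = x j"
    then have "scale (l i) (x i) = scale (l j) (x i)" using Tx by metis
    then show "i = j" using nz \<open>inj l\<close> by (auto dest: injD)
  qed
  have "independent (range x)"
  proof
    assume "dependent (range x)"
    then obtain t u v where t: "finite t" "t \<subseteq> range x" "v \<in> t" "u v \<noteq> 0" "(\<Sum>v\<in>t. scale (u v) v) = 0"
      unfolding dependent_explicit by blast
    interpret T: Vector_Spaces.linear scale scale T by fact
    have "scale (u v) v = 0"
    proof (rule eigenvectors_sum_zero[OF T t(1), where l = "\<lambda>v. l (inv x v)" and x = "\<lambda>v. scale (u v) v" and i = v])
      show "inj_on (\<lambda>v. l (inv x v)) t"
      proof (rule inj_onI)
        fix v w assume "v \<in> t" "w \<in> t" "l (inv x v) = l (inv x w)"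
        then show "v = w" using t(2) injD[OF \<open>inj l\<close>] by (metis f_inv_into_f subsetD)
      qed
      fix w assume "w \<in> t"
      then show "T (scale (u w) w) = scale (l (inv x w)) (scale (u w) w)"
        using t(2) Tx injx by (auto simp: T.scale mult.commute)
    qed (use t in auto)
    then show False using t nz by auto
  qed
  then have "finite (range x)" using independent_span_bound[OF \<open>finite B\<close>] assms(3) by blast
  then show False using injx range_inj_infinite by blast
qed

end

section \<open>Polynomials in an endomorphism, applied to a vector by Horner's rule\<close>

definition poly_act :: "(complex \<Rightarrow> 'v::ab_group_add \<Rightarrow> 'v) \<Rightarrow> ('v \<Rightarrow> 'v) \<Rightarrow> complex poly \<Rightarrow> 'v \<Rightarrow> 'v" where
  "poly_act s T p x = fold_coeffs (\<lambda>a y. s a x + T y) p 0"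

locale linear_endo = Vector_Spaces.linear s s T
  for s :: "complex \<Rightarrow> 'v::ab_group_add \<Rightarrow> 'v" and T
begin

lemma poly_act_0 [simp]: "poly_act s T 0 x = 0"
  by (simp add: poly_act_def)

lemma poly_act_pCons [simp]: "poly_act s T (pCons a p) x = s a x + T (poly_act s T p x)"
  by (cases "p = 0"; cases "a = 0") (auto simp: poly_act_def zero)

lemma poly_act_add: "poly_act s T (p + q) x = poly_act s T p x + poly_act s T q x"
  by (induction p q rule: poly_induct2) (simp_all add: add vs1.scale_left_distrib)

lemma poly_act_smult: "poly_act s T (smult c p) x = s c (poly_act s T p x)"
  by (induction p) (simp_all add: scale vs1.scale_right_distrib)

lemma poly_act_monom: "poly_act s T (monom c i) x = s c ((T ^^ i) x)"
  by (induction i) (simp_all add: monom_Suc monom_0 zero scale)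

lemma poly_act_sum: "poly_act s T (\<Sum>i\<in>I. p i) x = (\<Sum>i\<in>I. poly_act s T (p i) x)"
  by (induction I rule: infinite_finite_induct) (simp_all add: poly_act_add)

lemma poly_act_root_factor:
  "poly_act s T ([:- r, 1:] * q) x = T (poly_act s T q x) - s r (poly_act s T q x)"
  using poly_act_add[of "smult (- r) q" "pCons 0 q" x] by (simp add: poly_act_smult del: smult_minus_left)

text \<open>Linear factors are split off \<open>p\<close> one at a time; the last nonzero vector
  before annihilation is an eigenvector for the factor removed next.\<close>

lemma eigenvector_from_annihilator:
  assumes "p \<noteq> 0" "poly_act s T p x = 0" "x \<noteq> 0"
  shows "\<exists>r q. poly_act s T q x \<noteq> 0 \<and> T (poly_act s T q x) = s r (poly_act s T q x)"
  using assms
proof (induction "degree p" arbitrary: p)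
  case 0
  then obtain a where "p = [:a:]" using degree_0_id by (metis degree_eq_zeroE)
  then show ?case using 0 by (simp add: zero)
next
  case (Suc d)
  then have "\<not> constant (poly p)" by (simp add: constant_degree)
  then obtain r where "poly p r = 0" using fundamental_theorem_of_algebra by blast
  then obtain q where q: "p = [:- r, 1:] * q" using poly_eq_0_iff_dvd by blast
  then have "q \<noteq> 0" using Suc by auto
  show ?case
  proof (cases "poly_act s T q x = 0")
    case True
    have "degree p = Suc (degree q)" using \<open>q \<noteq> 0\<close> unfolding q by (subst degree_mult_eq) auto
    then show ?thesis using Suc \<open>q \<noteq> 0\<close> True by auto
  next
    case False
    then show ?thesis using Suc.prems(2) unfolding q poly_act_root_factor by auto
  qed
qed

text \<open>If two iterates coincide, a difference of monomials annihilates \<open>x\<close>.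
  Otherwise the orbit is infinite, hence dependent, and injectivity turns a relation between its
  vectors into a polynomial.\<close>

lemma annihilator_in_finite_span:
  assumes "finite B" "\<And>i. (T ^^ i) x \<in> vs1.span B"
  shows "\<exists>p. p \<noteq> 0 \<and> poly_act s T p x = 0"
proof (cases "inj (\<lambda>i. (T ^^ i) x)")
  case False
  then obtain i j where ij: "i \<noteq> j" "(T ^^ i) x = (T ^^ j) x" by (auto simp: inj_def)
  have "poly_act s T (monom 1 i + monom (- 1) j) x = 0" by (simp add: poly_act_add poly_act_monom ij(2))
  moreover have "coeff (monom 1 i + monom (- 1 :: complex) j) i = 1" using ij(1) by simp
  ultimately show ?thesis by (metis coeff_0 zero_neq_one)
next
  case inj: True
  let ?g = "\<lambda>i. (T ^^ i) x"
  have "vs1.dependent (range ?g)"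
    using vs1.independent_span_bound[OF assms(1)] assms(2) range_inj_infinite[OF inj] by blast
  then obtain t u v where t: "finite t" "t \<subseteq> range ?g" "v \<in> t" "u v \<noteq> 0" "(\<Sum>v\<in>t. s (u v) v) = 0"
    unfolding vs1.dependent_explicit by blast
  obtain J where J: "finite J" "t = ?g ` J" using finite_subset_image[OF t(1,2)] by auto
  define p where "p = (\<Sum>i\<in>J. monom (u (?g i)) i)"
  have "poly_act s T p x = 0"
    using t(5) sum.reindex[OF inj_on_subset[OF inj subset_UNIV], of "\<lambda>v. s (u v) v" J]
    by (simp add: p_def poly_act_sum poly_act_monom J(2))
  moreover obtain i where i: "i \<in> J" "v = ?g i" using t(3) J by auto
  have "coeff p i = u v" using i J(1) by (simp add: p_def coeff_sum)
  then have "p \<noteq> 0" using t(4) by auto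
  ultimately show ?thesis by blast
qed

lemma poly_act_in_subspace:
  assumes "vs1.subspace W" "\<And>y. y \<in> W \<Longrightarrow> T y \<in> W" "x \<in> W"
  shows "poly_act s T p x \<in> W"
  using assms by (induction p) (auto intro: vs1.subspace_add vs1.subspace_scale vs1.subspace_0)

lemma span_orbit: "vs1.span (range (\<lambda>i. (T ^^ i) x)) \<subseteq> range (\<lambda>p. poly_act s T p x)"
proof (rule vs1.span_minimal)
  show "range (\<lambda>i. (T ^^ i) x) \<subseteq> range (\<lambda>p. poly_act s T p x)"
  proof safe
    fix i show "(T ^^ i) x \<in> range (\<lambda>p. poly_act s T p x)"
      using poly_act_monom[of 1 i x] by (auto intro!: range_eqI[of _ _ "monom 1 i"])
  qed
  show "vs1.subspace (range (\<lambda>p. poly_act s T p x))"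
    unfolding vs1.subspace_def
  proof safe
    show "0 \<in> range (\<lambda>p. poly_act s T p x)" by (rule rev_image_eqI[of 0]) auto
  next
    fix p q show "poly_act s T p x + poly_act s T q x \<in> range (\<lambda>p. poly_act s T p x)"
      by (auto simp flip: poly_act_add)
  next
    fix c p show "s c (poly_act s T p x) \<in> range (\<lambda>p. poly_act s T p x)"
      by (auto simp flip: poly_act_smult)
  qed
qed

lemma eigenvector_in_finite_span:
  assumes "finite B" "\<And>y. y \<in> vs1.span B \<Longrightarrow> T y \<in> vs1.span B" "x \<in> vs1.span B" "x \<noteq> 0"
  shows "\<exists>r y. y \<in> vs1.span B \<and> y \<noteq> 0 \<and> T y = s r y"
proof -
  have "(T ^^ i) x \<in> vs1.span B" for i by (induction i) (simp_all add: assms)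
  then obtain p where "p \<noteq> 0" "poly_act s T p x = 0" using annihilator_in_finite_span assms(1) by blast
  then obtain r q where "poly_act s T q x \<noteq> 0" "T (poly_act s T q x) = s r (poly_act s T q x)"
    using eigenvector_from_annihilator assms(4) by blast
  moreover have "poly_act s T q x \<in> vs1.span B" using poly_act_in_subspace[OF vs1.subspace_span] assms by blast
  ultimately show ?thesis by blast
qed

end

section \<open>Simple modules\<close>

lemma fp_eigenvalue_eq_iff: "fp_eigenvalue n i j = fp_eigenvalue m k l \<longleftrightarrow> n + j = m + l \<and> i = k"
proof
  assume a: "fp_eigenvalue n i j = fp_eigenvalue m k l"
  have "real ((n + j) * (n + j + 2)) = real ((m + l) * (m + l + 2))"
    using arg_cong[OF a, of Re] by (simp add: fp_eigenvalue_def)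
  then have "(n + j) * (n + j + 2) = (m + l) * (m + l + 2)" by (simp only: of_nat_eq_iff)
  moreover have "a * (a + 2) < b * (b + 2)" if "a < b" for a b :: nat
    using that by (intro mult_strict_mono) auto
  ultimately have nm: "n + j = m + l" by (metis less_irrefl linorder_neqE_nat)
  have "real (n + j) - 2 * real i = real (m + l) - 2 * real k"
    using arg_cong[OF a, of Im] by (simp add: fp_eigenvalue_def)
  with nm have "real i = real k" by linarith
  with nm show "n + j = m + l \<and> i = k" by simp
qed (auto simp: fp_eigenvalue_def)

section \<open>Eigenspaces of \<open>casimir_h\<close> in generated submodules, and existence of a
  lowest vector\<close>

context schr_module
begin

lemma linear_T: "Vector_Spaces.linear sc sc T"
  unfolding Vector_Spaces.linear_iff
  by (auto simp: vector_space_axioms casimir_h_def act_linear scale_right_distrib) (simp add: algebra_simps)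

lemma T_Z: "T (Z x) = Z (T x)"
  by (simp add: casimir_h_def act_Z_commute act_linear)

lemma fp_00: "fp M 0 0 x = x"
  by (simp add: fp_def)

lemma T_eigenspace_gen:
  assumes "\<And>y. y \<in> Y \<Longrightarrow> lowest M n y" "x \<in> gen n Y" "T x = sc m x"
  shows "x \<in> span {fp M i j y | i j y. i \<le> n + j \<and> fp_eigenvalue n i j = m \<and> y \<in> Y}"
proof -
  have "x \<in> span {s \<in> gens M n Y. T s = sc m s}"
    by (rule eigenvector_in_span[OF linear_T])
      (use assms in \<open>auto simp: gen_def gens_def dest: T_fp[OF assms(1)]\<close>)
  also have "\<dots> \<subseteq> span {fp M i j y | i j y. i \<le> n + j \<and> fp_eigenvalue n i j = m \<and> y \<in> Y}" (is "_ \<subseteq> span ?R")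
  proof (rule span_minimal)
    show "{s \<in> gens M n Y. T s = sc m s} \<subseteq> span ?R"
    proof
      fix s assume "s \<in> {s \<in> gens M n Y. T s = sc m s}"
      then obtain i j y where s: "s = fp M i j y" "i \<le> n + j" "y \<in> Y" "T s = sc m s" by (auto simp: gens_def)
      then have "sc (fp_eigenvalue n i j) s = sc m s" using T_fp assms(1) by metis
      \<comment> \<open>A vanishing generator satisfies the eigenvalue equation for every value, so
        it is treated separately.\<close>
      then have "s = 0 \<or> fp_eigenvalue n i j = m" by auto
      then show "s \<in> span ?R" using s span_zero span_base[of s ?R] by auto
    qed
  qed simp
  finally show ?thesis .
qed

text \<open>The eigenvalue of index \<open>(0, 0)\<close> occurs for no other index, so only the
  generators \<open>y\<close> themselves remain.\<close>

lemma T_eigenspace_gen_00: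
  assumes "\<And>y. y \<in> Y \<Longrightarrow> lowest M n y" "subspace Y" "x \<in> gen n Y" "T x = sc (fp_eigenvalue n 0 0) x"
  shows "x \<in> Y"
proof -
  have "{fp M i j y | i j y. i \<le> n + j \<and> fp_eigenvalue n i j = fp_eigenvalue n 0 0 \<and> y \<in> Y} \<subseteq> Y"
    by (auto simp: fp_eigenvalue_eq_iff fp_00)
  then show ?thesis using T_eigenspace_gen[OF assms(1,3,4)] span_minimal[OF _ assms(2)] by blast
qed

lemma T_lowest: "lowest M n x \<Longrightarrow> T x = sc (fp_eigenvalue n 0 0) x"
  using T_fp[of n x 0 0] by (simp add: fp_00)

lemma lowering_linear: "lowering M k (x + y) = lowering M k x + lowering M k y"
  "lowering M k (sc c x) = sc c (lowering M k x)" "lowering M k 0 = 0"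
  by (simp_all add: lowering_def act_linear algebra_simps)

lemma subspace_lowest: "subspace {x. lowest M n x}"
  by (auto simp: subspace_def lowest_def primitive_def lowering_linear act_linear funpow_linear scale_right_distrib mult.commute)

lemma lowest_Z: "lowest M n x \<Longrightarrow> lowest M n (Z x)"
  using funpow_Z[where a = b_f and i = "Suc n" and x = x]
  by (auto simp: lowest_def primitive_def lowering_def act_Z_commute simp flip: act_scale act_diff simp del: funpow.simps)

text \<open>Let \<open>f^(i+1)\<close> be the first power of \<open>f\<close> that kills
  \<open>x\<close>. Applying \<open>e\<close> to \<open>f^(i+1) x = 0\<close> gives
  \<open>(i + 1) (k - i) f^i x = 0\<close>.\<close>

lemma primitive_weight_nat:
  assumes "primitive M k x" "x \<noteq> 0" "(F ^^ N) x = 0"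
  shows "\<exists>i::nat. k = of_nat i \<and> (F ^^ Suc i) x = 0 \<and> (F ^^ i) x \<noteq> 0"
proof -
  define N where "N = (LEAST N. (F ^^ N) x = 0)"
  have N: "(F ^^ N) x = 0" unfolding N_def by (rule LeastI) fact
  then obtain i where i: "N = Suc i" using assms(2) by (cases N) auto
  have ne: "(F ^^ i) x \<noteq> 0" using not_less_Least[of i "\<lambda>N. (F ^^ N) x = 0"] i N_def by simp
  have "E ((F ^^ Suc i) x) = sc (of_nat (Suc i) * (k - of_nat i)) ((F ^^ i) x)"
    unfolding E_funpow_F using assms(1) by (simp add: primitive_def funpow_linear algebra_simps)
  then have "of_nat (Suc i) * (k - of_nat i) = 0" using N i ne by simp
  then have "k = of_nat i" by (simp del: of_nat_Suc)
  then show ?thesis using N i ne by auto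
qed

text \<open>Raising an \<open>h\<close>-eigenvector of a finite-dimensional summand by
  \<open>e\<close> until it dies gives a highest weight vector. Among all such vectors killed by a
  power of \<open>f\<close>, one of minimal weight \<open>n\<close> is taken: a nonzero value of
  \<open>lowering\<close> on it would be one of weight \<open>n - 1\<close>.\<close>

lemma lowest_exists:
  assumes hc: "harish_chandra M" and nz: "(UNIV :: 'v set) \<noteq> {0}"
  shows "\<exists>n x. x \<noteq> 0 \<and> lowest M n x"
proof -
  obtain \<W> where W: "is_direct_sum M \<W>" "\<And>W. W \<in> \<W> \<Longrightarrow> simple_submodule sl2 M W \<and> fin_dim M W"
    using hc unfolding harish_chandra_def by blast
  have "\<W> \<noteq> {}" using W(1) nz by (auto simp: is_direct_sum_def)
  then obtain W where "W \<in> \<W>" by blast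
  with W have sW: "simple_submodule sl2 M W" "fin_dim M W" by auto
  have "b_e \<in> sl2" "b_h \<in> sl2" "b_f \<in> sl2" by (auto simp: sl2_def intro: vec.span_base)
  then have st: "E x \<in> W" "H x \<in> W" "F x \<in> W" if "x \<in> W" for x
    using sW(1) that by (auto simp: simple_submodule_def submodule_def)
  obtain B where B: "finite B" "span B = W" using sW(2) by (auto simp: fin_dim_def)
  obtain x where x: "x \<in> W" "x \<noteq> 0" using sW(1) B(2) span_zero[of B] by (auto simp: simple_submodule_def)
  interpret H: linear_endo sc H by (simp add: linear_endo_def linear_act)
  obtain l y where y: "y \<in> W" "y \<noteq> 0" "H y = sc l y"
    using H.eigenvector_in_finite_span[OF B(1), of x] x st(2) by (auto simp: B(2))
  have HE': "H ((E ^^ i) y) = sc (l + 2 * of_nat i) ((E ^^ i) y)" for i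
    by (induction i) (simp_all add: y HE act_linear algebra_simps scale_2)
  have "(E ^^ i) y \<in> W" for i by (induction i) (auto simp: y st)
  then have ex: "\<exists>i. (E ^^ i) y = 0"
    by (intro eigensequence_reaches_zero[OF linear_act[of b_h] B(1), of _ "\<lambda>i. l + 2 * of_nat i"])
      (auto simp: B(2) HE' inj_def)
  define N where "N = (LEAST N. (E ^^ N) y = 0)"
  have N: "(E ^^ N) y = 0" unfolding N_def by (rule LeastI_ex) fact
  then obtain i where i: "N = Suc i" using y(2) by (cases N) auto
  define u where "u = (E ^^ i) y"
  have "u \<noteq> 0" using not_less_Least[of i "\<lambda>N. (E ^^ N) y = 0"] i N_def by (simp add: u_def)
  have uW: "u \<in> W" unfolding u_def by fact
  have pu: "primitive M (l + 2 * of_nat i) u" using N i HE' by (simp add: primitive_def u_def)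
  have "(F ^^ j) u \<in> W" for j by (induction j) (auto simp: uW st)
  then have ex': "\<exists>j. (F ^^ j) u = 0"
    using pu by (intro eigensequence_reaches_zero[OF linear_act[of b_h] B(1), of _ "\<lambda>j. l + 2 * of_nat i - 2 * of_nat j"])
      (auto simp: B(2) H_funpow_F primitive_def funpow_linear scale_left_diff_distrib inj_def)
  have "\<exists>k x. x \<noteq> 0 \<and> primitive M (of_nat k) x \<and> (F ^^ Suc k) x = 0"
    using primitive_weight_nat[OF pu \<open>u \<noteq> 0\<close>] ex' pu \<open>u \<noteq> 0\<close> by metis
  moreover define n where "n = (LEAST k. \<exists>x. x \<noteq> 0 \<and> primitive M (of_nat k) x \<and> (F ^^ Suc k) x = 0)"
  ultimately obtain v where v: "v \<noteq> 0" "primitive M (of_nat n) v" "(F ^^ Suc n) v = 0"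
    unfolding n_def by (smt (verit, ccfv_threshold) LeastI)
  have "lowering M (of_nat n) v = 0"
  proof (cases n)
    case 0
    then show ?thesis using v by (simp add: lowering_def)
  next
    case (Suc m)
    let ?d = "lowering M (of_nat n) v"
    show ?thesis
    proof (rule ccontr)
      assume nz: "?d \<noteq> 0"
      have pd: "primitive M (of_nat m) ?d" using primitive_lowering[OF v(2)] Suc by simp
      have F0: "(F ^^ (k + Suc n)) v = 0" for k using v(3) by (simp only: Nat.funpow_add o_apply funpow_zero)
      \<comment> \<open>Both terms on the right contain a power of \<open>f\<close> above
        \<open>n\<close> applied to \<open>v\<close>, so a power of \<open>f\<close> kills the
        vector \<open>?d\<close>.\<close>
      have "(F ^^ Suc (Suc n)) (P (F v)) = P ((F ^^ Suc (Suc n)) (F v)) + sc (of_nat (Suc (Suc n))) (Q ((F ^^ Suc n) (F v)))"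
        unfolding P_funpow_F Q_funpow_F by simp
      also have "\<dots> = 0" using F0[of 1] F0[of 2] by (simp add: funpow_swap1)
      finally have "(F ^^ Suc (Suc n)) ?d = 0"
        using F0[of 1] by (simp only: lowering_def funpow_linear Q_funpow_F[symmetric]) simp
      from primitive_weight_nat[OF pd nz this] have "(F ^^ Suc m) ?d = 0" by auto
      then show False using pd nz not_less_Least[of m "\<lambda>k. \<exists>x. x \<noteq> 0 \<and> primitive M (of_nat k) x \<and> (F ^^ Suc k) x = 0"] Suc
        unfolding n_def[symmetric] by auto
    qed
  qed
  then show ?thesis using v by (auto simp: lowest_def)
qed

section \<open>The central character of a simple module\<close>

lemma simple_submodule_cases:
  assumes "simple_smodule M" "submodule UNIV M W"
  shows "W = {0} \<or> W = UNIV"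
  using assms by (auto simp: simple_smodule_def simple_submodule_def)

lemma submodule_zeigen: "submodule UNIV M {x. Z x = sc r x}"
  unfolding submodule_def
  by (auto simp: subspace_def act_linear scale_right_distrib mult.commute simp flip: act_Z_commute)

text \<open>If \<open>z\<close> is not zero it is invertible, so \<open>v \<in> z (\<complex>[z] v)\<close>. This gives a nonzero polynomial in \<open>z\<close>
  that annihilates \<open>v\<close>, hence an eigenvector of \<open>z\<close>.\<close>

lemma central_character:
  assumes simple: "simple_smodule M" and v: "v \<noteq> 0" "lowest M n v"
  shows "\<exists>c. \<forall>x. Z x = sc c x"
proof -
  have scalar: "\<exists>c. \<forall>x. Z x = sc c x" if "y \<noteq> 0" "Z y = sc r y" for y r
    using simple_submodule_cases[OF simple submodule_zeigen[of r]] that by auto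
  define Y where "Y = span (range (\<lambda>l. (Z ^^ l) v))"
  have subY: "subspace Y" by (simp add: Y_def)
  have lowv: "lowest M n ((Z ^^ l) v)" for l by (induction l) (auto simp: v lowest_Z)
  have low: "lowest M n y" if "y \<in> Y" for y
    using span_minimal[OF _ subspace_lowest, of "range (\<lambda>l. (Z ^^ l) v)"] that lowv by (auto simp: Y_def)
  have Zst: "Z y \<in> Y" if "y \<in> Y" for y
    using that unfolding Y_def
  proof (induction rule: span_induct_alt)
    case base then show ?case by (simp add: span_zero)
  next
    case (step c x y)
    then obtain l where "x = (Z ^^ l) v" by blast
    then have "Z x \<in> range (\<lambda>l. (Z ^^ l) v)" by (auto intro: range_eqI[of _ _ "Suc l"])
    then show ?case unfolding act_linear using step by (intro span_add span_scale) (auto intro: span_base)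
  qed
  have vY: "v \<in> Y" unfolding Y_def by (intro span_base range_eqI[of _ _ 0]) simp
  have top: "gen n Y = UNIV"
    using simple_submodule_cases[OF simple gen_submodule[OF subY low Zst]] subset_gen[of Y n] vY v(1) by auto
  have range_sub: "submodule UNIV M (range Z)"
    unfolding submodule_def
  proof (intro conjI ballI)
    show "subspace (range Z)"
      by (auto simp: subspace_def simp flip: act_linear) (metis act_zero rangeI)
    fix a x assume "x \<in> range Z" then show "act M a x \<in> range Z" by (auto simp: act_Z_commute)
  qed
  show ?thesis
  proof (cases "Z v = 0")
    case True
    then show ?thesis using scalar[of v 0] v by simp
  next
    case False
    then have "range Z = UNIV" using simple_submodule_cases[OF simple range_sub] by (metis rangeI singletonD)
    then obtain x where x: "Z x = v" by (metis surjD)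
    have inj: "y = 0" if "Z y = 0" for y
      using simple_submodule_cases[OF simple submodule_zeigen[of 0]] that False by auto
    interpret T: Vector_Spaces.linear sc sc T by (rule linear_T)
    \<comment> \<open>Injectivity of \<open>z\<close> transfers the eigenvalue of
      \<open>v = z x\<close> to \<open>x\<close>, which places \<open>x\<close> in
      \<open>Y\<close>.\<close>
    have "Z (T x - sc (fp_eigenvalue n 0 0) x) = 0"
      by (simp add: act_linear T_Z[symmetric] x T_lowest v)
    from inj[OF this] have "T x = sc (fp_eigenvalue n 0 0) x" by simp
    then have "x \<in> Y" using T_eigenspace_gen_00[OF low subY] top by auto
    interpret Z: linear_endo sc Z by (simp add: linear_endo_def linear_act)
    from \<open>x \<in> Y\<close> obtain p where p: "x = poly_act sc Z p v" using Z.span_orbit unfolding Y_def by blast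
    \<comment> \<open>With \<open>x = p(z) v\<close>, the equation \<open>z x = v\<close> says that
      the polynomial with constant term \<open>-1\<close> and tail \<open>p\<close> annihilates
      \<open>v\<close>; the constant term makes it nonzero.\<close>
    have "poly_act sc Z (pCons (- 1) p) v = 0" using p x by simp
    then obtain r q where "poly_act sc Z q v \<noteq> 0" "Z (poly_act sc Z q v) = sc r (poly_act sc Z q v)"
      using Z.eigenvector_from_annihilator[of "pCons (- 1) p" v] v by auto
    then show ?thesis using scalar by blast
  qed
qed

lemma gen_line:
  assumes simple: "simple_smodule M" and v: "v \<noteq> 0" "lowest M n v" and Z: "\<And>x. Z x = sc c x"
  shows "gen n (span {v}) = UNIV"
proof -
  have low: "lowest M n y" if "y \<in> span {v}" for y
    using span_minimal[OF _ subspace_lowest, of "{v}"] v that by auto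
  have "submodule UNIV M (gen n (span {v}))"
    by (rule gen_submodule) (auto simp: low Z intro: span_scale)
  moreover have "v \<in> gen n (span {v})" using subset_gen[of "span {v}" n] span_base[of v "{v}"] by blast
  ultimately show ?thesis using simple_submodule_cases[OF simple] v(1) by blast
qed

text \<open>If \<open>z = 0\<close>, then \<open>p v\<close> is again a lowest vector, of weight
  \<open>n + 1\<close>. When nonzero it generates a submodule in which the eigenvalue of
  \<open>v\<close> is missing; when zero, the vectors \<open>f^i v\<close> with
  \<open>i \<le> n\<close> already span \<open>V\<close>.\<close>

lemma central_character_nonzero:
  assumes simple: "simple_smodule M" and v: "v \<noteq> 0" "lowest M n v" and Z: "\<And>x. Z x = sc c x"
    and inf: "\<not> fin_dim M UNIV"
  shows "c \<noteq> 0"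
proof
  assume "c = 0"
  then have Z0: "Z x = 0" for x by (simp add: Z)
  have pv: "primitive M (of_nat n) v" using v by (simp add: lowest_def)
  have lP: "lowest M (Suc n) (P v)"
    using primitive_P[OF pv] lowering_P[OF pv] funpow_F_P[OF v(2), of 1] v(2)
    by (simp add: lowest_def Z0 add.commute)
  show False
  proof (cases "P v = 0")
    case False
    then have "gen (Suc n) (span {P v}) = UNIV" using gen_line[OF simple _ lP Z] by blast
    then have "v \<in> gen (Suc n) (span {P v})" by simp
    moreover have "lowest M (Suc n) y" if "y \<in> span {P v}" for y
      using span_minimal[OF _ subspace_lowest, of "{P v}"] lP that by auto
    ultimately have "v \<in> span {fp M i j y | i j y. i \<le> Suc n + j \<and> fp_eigenvalue (Suc n) i j = fp_eigenvalue n 0 0 \<and> y \<in> span {P v}}"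
      using T_eigenspace_gen T_lowest[OF v(2)] by blast
    \<comment> \<open>Equality of the eigenvalues would force \<open>Suc n + j = n\<close>, so the
      spanning set is empty.\<close>
    also have "\<dots> = {0}" by (simp add: fp_eigenvalue_eq_iff)
    finally show False using v(1) by simp
  next
    case True
    have "gens M n (span {v}) \<subseteq> span ((\<lambda>i. (F ^^ i) v) ` {..n})"
    proof
      fix s assume "s \<in> gens M n (span {v})"
      then obtain i j y where s: "s = fp M i j y" "i \<le> n + j" "y \<in> span {v}" by (auto simp: gens_def)
      then obtain a where y: "y = sc a v" by (auto simp: span_singleton)
      show "s \<in> span ((\<lambda>i. (F ^^ i) v) ` {..n})"
      proof (cases j)
        case 0
        then show ?thesis using s(2) by (auto simp: s(1) y fp_def funpow_linear intro: span_scale[OF span_base])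
      next
        case (Suc j')
        then have "s = 0" by (simp add: s(1) y fp_def act_linear True funpow_Suc_right del: funpow.simps)
        then show ?thesis by (simp add: span_zero)
      qed
    qed
    then have "UNIV \<subseteq> span ((\<lambda>i. (F ^^ i) v) ` {..n})"
      unfolding gen_line[OF simple v Z, symmetric] unfolding gen_def by (intro span_minimal) auto
    then have "fin_dim M UNIV" unfolding fin_dim_def by (intro exI[of _ "(\<lambda>i. (F ^^ i) v) ` {..n}"]) auto
    then show False using inf by blast
  qed
qed

end

section \<open>Commutation of \<open>casimir_h\<close> with \<open>sl2\<close>\<close>

context schr_module
begin

lemma scale_4: "sc 4 x = x + x + x + x"
  using scale_left_distrib[of 2 2 x] by (simp add: scale_2 add.assoc)

lemma scale_2i: "sc (2 * \<i>) x = sc \<i> x + sc \<i> x"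
  by (simp only: mult_2 scale_left_distrib)

text \<open>The Casimir part commutes with \<open>e\<close>, so the shift comes entirely from the
  summand \<open>\<i> h\<close>.\<close>

lemma T_E: "T (E x) = E (T x) + sc (2 * \<i>) (E x)"
  unfolding scale_2i by (simp add: casimir_h_def EF HE HF act_linear algebra_simps scale_2 scale_4)

lemma T_H: "T (H x) = H (T x)"
  by (simp add: casimir_h_def EF HE HF act_linear algebra_simps scale_2)

lemma T_F: "T (F x) = F (T x) - sc (2 * \<i>) (F x)"
  unfolding scale_2i by (simp add: casimir_h_def EF HE HF act_linear algebra_simps scale_2 scale_4)

lemma T_funpow_F: "T ((F ^^ i) x) = (F ^^ i) (T x) - sc (2 * of_nat i * \<i>) ((F ^^ i) x)"
proof (induction i)
  case (Suc i)
  show ?case by (simp only: funpow.simps o_apply T_F Suc.IH)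
    (simp add: act_linear scale_left_distrib ring_distribs)
qed simp

lemma T_primitive: "primitive M k x \<Longrightarrow> T x = sc (k * (k + 2) + \<i> * k) x"
  by (simp add: primitive_def casimir_h_def act_linear algebra_simps)

lemma gen_subset:
  assumes W: "submodule UNIV M W" and "Y \<subseteq> W"
  shows "gen n Y \<subseteq> W"
  unfolding gen_def
proof (rule span_minimal)
  show "subspace W" using W by (simp add: submodule_def)
  have pow: "(act M a ^^ i) x \<in> W" if "x \<in> W" for a i x
    using that W by (induction i) (auto simp: submodule_def)
  show "gens M n Y \<subseteq> W" using assms(2) by (auto simp: gens_def fp_def intro!: pow)
qed

lemma lowest_F_eq_0: "lowest M n x \<Longrightarrow> (F ^^ n) x = 0 \<Longrightarrow> x = 0"
  using primitive_weight_nat[of "of_nat n" x n] by (auto simp: lowest_def)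

lemma lowest_in_span:
  assumes "\<And>y. y \<in> Y \<Longrightarrow> lowest M n y" "y \<in> span Y"
  shows "lowest M n y"
  using span_minimal[OF _ subspace_lowest, of Y n] assms by blast

end

text \<open>When \<open>x\<close> is a suitable lift of \<open>v\<close>, these are the eigenvalues
  that \<open>e x\<close> and \<open>lowering x\<close> would have. The first would put
  \<open>h\<close>-weight \<open>n + 2\<close> into an \<open>sl2\<close>-module of highest weight
  \<open>n\<close>; the second would need highest weight \<open>n - 1\<close>.\<close>

lemma fp_eigenvalue_noteq:
  "fp_eigenvalue n i j \<noteq> fp_eigenvalue n 0 0 + 2 * \<i>"
  "fp_eigenvalue n i j \<noteq> (of_nat n - 1) * (of_nat n - 1 + 2) + \<i> * (of_nat n - 1)"
proof
  assume a: "fp_eigenvalue n i j = fp_eigenvalue n 0 0 + 2 * \<i>"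
  have "real ((n + j) * (n + j + 2)) = real (n * (n + 2))"
    using arg_cong[OF a, of Re] by (simp add: fp_eigenvalue_def)
  then have "(n + j) * (n + j + 2) = n * (n + 2)" by (simp only: of_nat_eq_iff)
  then have "j = 0" by (simp add: algebra_simps)
  then show False using arg_cong[OF a, of Im] by (simp add: fp_eigenvalue_def)
next
  show "fp_eigenvalue n i j \<noteq> (of_nat n - 1) * (of_nat n - 1 + 2) + \<i> * (of_nat n - 1)"
  proof
    assume a: "fp_eigenvalue n i j = (of_nat n - 1) * (of_nat n - 1 + 2) + \<i> * (of_nat n - 1)"
    have "real ((n + j) * (n + j + 2)) = (real n - 1) * (real n + 1)"
      using arg_cong[OF a, of Re] by (simp add: fp_eigenvalue_def)
    then have "real ((n + j) * (n + j + 2) + 1) = real (n * n)" by (simp add: algebra_simps)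
    then have "(n + j) * (n + j + 2) + 1 = n * n" by (simp only: of_nat_eq_iff)
    then show False by (simp add: algebra_simps)
  qed
qed

section \<open>Self-extensions\<close>

lemma smodule_homD:
  assumes "smodule_hom M N \<phi>"
  shows "\<phi> (x + y) = \<phi> x + \<phi> y" "\<phi> (scl M c x) = scl N c (\<phi> x)" "\<phi> (act M a x) = act N a (\<phi> x)"
    "\<phi> 0 = 0" "\<phi> (x - y) = \<phi> x - \<phi> y" "\<phi> (- x) = - \<phi> x"
proof -
  show add: "\<phi> (x + y) = \<phi> x + \<phi> y" for x y using assms by (simp add: hom_on_def)
  show diff: "\<phi> (x - y) = \<phi> x - \<phi> y" for x y using add[of "x - y" y] by simp
  show "\<phi> 0 = 0" using diff[of 0 0] by simp
  then show "\<phi> (- x) = - \<phi> x" using diff[of 0 x] by simp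
qed (use assms in \<open>auto simp: hom_on_def\<close>)

lemma smodule_hom_funpow:
  "smodule_hom M N \<phi> \<Longrightarrow> \<phi> ((act M a ^^ i) x) = (act N a ^^ i) (\<phi> x)"
  by (induction i) (simp_all add: smodule_homD)

lemma smodule_hom_fp: "smodule_hom M N \<phi> \<Longrightarrow> \<phi> (fp M i j x) = fp N i j (\<phi> x)"
  by (simp add: fp_def smodule_hom_funpow)

lemma smodule_hom_lowest:
  assumes "smodule_hom M N \<phi>" "lowest M n x"
  shows "lowest N n (\<phi> x)"
  using assms smodule_hom_funpow[OF assms(1), where a = b_f and i = "Suc n" and x = x]
  by (auto simp: lowest_def primitive_def lowering_def smodule_homD[OF assms(1)]
      simp flip: smodule_homD(2,3,5)[OF assms(1)])

lemma smodule_hom_casimir: "smodule_hom M N \<phi> \<Longrightarrow> \<phi> (casimir_h M x) = casimir_h N (\<phi> x)"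
  by (simp add: casimir_h_def smodule_homD)

lemma submodule_vimage:
  assumes "is_smodule M" "is_smodule N" "smodule_hom M N \<phi>" "submodule UNIV N W"
  shows "submodule UNIV M {x. \<phi> x \<in> W}"
proof -
  interpret M: schr_module M by standard fact
  interpret N: schr_module N by standard fact
  show ?thesis using assms(4)
    by (auto simp: submodule_def M.subspace_def N.subspace_def smodule_homD[OF assms(3)])
qed

lemma submodule_image:
  assumes "is_smodule M" "is_smodule N" "smodule_hom M N \<phi>" "submodule UNIV M W"
  shows "submodule UNIV N (\<phi> ` W)"
proof -
  interpret M: schr_module M by standard fact
  interpret N: schr_module N by standard fact
  show ?thesis using assms(4)
    by (auto simp: submodule_def M.subspace_def N.subspace_def image_iff
        simp flip: smodule_homD[OF assms(3)])
qed

text \<open>The short five lemma: a morphism that is the identity on both ends is bijective.\<close>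

lemma ext_equivI:
  assumes X: "is_extension V W X" and Y: "is_extension V W Y"
    and hom: "smodule_hom (mid X) (mid Y) \<phi>"
    and inc: "\<And>m. \<phi> (inc X m) = inc Y m" and prj: "\<And>x. prj Y (\<phi> x) = prj X x"
  shows "ext_equiv X Y"
  unfolding ext_equiv_def
proof (intro exI conjI allI)
  have homs: "smodule_hom (mid X) V (prj X)" "smodule_hom (mid Y) V (prj Y)" "smodule_hom W (mid Y) (inc Y)"
    and bij: "inj (inc Y)" "surj (prj X)"
    and ker: "\<And>x. prj X x = 0 \<Longrightarrow> x \<in> range (inc X)" "\<And>x. prj Y x = 0 \<Longrightarrow> x \<in> range (inc Y)"
    using X Y by (auto simp: is_extension_def)
  have "x = 0" if "\<phi> x = 0" for x
  proof -
    have "prj X x = 0" using that prj[of x] smodule_homD(4)[OF homs(2)] by simp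
    then obtain m where m: "x = inc X m" using ker(1) by blast
    then have "inc Y m = inc Y 0" using that inc smodule_homD(4)[OF homs(3)] by simp
    then have "m = 0" using bij(1) by (simp add: inj_eq)
    then show ?thesis using m inc X smodule_homD(4) unfolding is_extension_def by metis
  qed
  then have "inj \<phi>" by (metis injI smodule_homD(5)[OF hom] eq_iff_diff_eq_0)
  moreover have "y \<in> range \<phi>" for y
  proof -
    obtain x where x: "prj X x = prj Y y" using bij(2) by (metis surjD)
    then have "prj Y (y - \<phi> x) = 0" by (simp add: smodule_homD[OF homs(2)] prj)
    then obtain m where "y - \<phi> x = \<phi> (inc X m)" using ker(2) inc by force
    then have "y = \<phi> (inc X m + x)" by (simp add: smodule_homD[OF hom] flip: \<open>y - \<phi> x = \<phi> (inc X m)\<close>)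
    then show ?thesis by blast
  qed
  ultimately show "bij \<phi>" by (auto simp: bij_def)
qed (use assms in auto)

section \<open>Self-extensions and their parameter\<close>

locale schr_simple = schr_module V for V :: "'v::ab_group_add smodule" +
  fixes n :: nat and v :: 'v and c :: complex
  assumes simple: "simple_smodule V" and v_nonzero: "v \<noteq> 0" and lowest_v: "lowest V n v"
    and Z_scalar: "\<And>x. Z x = sc c x" and c_nonzero: "c \<noteq> 0"
begin

lemma submodule_top: "submodule UNIV V W \<Longrightarrow> v \<in> W \<Longrightarrow> W = UNIV"
  using simple_submodule_cases[OF simple] v_nonzero by blast

lemma gen_v: "gen n (span {v}) = UNIV"
  using gen_line[OF simple v_nonzero lowest_v Z_scalar] .

text \<open>The parameter is the first-order change of the central character along the
  extension.\<close>

definition has_parameter :: "('e::ab_group_add, 'v, 'v) extension \<Rightarrow> complex \<Rightarrow> bool" where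
  "has_parameter X b \<longleftrightarrow> (\<forall>y. act (mid X) b_z y = scl (mid X) c y + inc X (sc b (prj X y)))"

end

locale schr_self_extension = schr_simple V n v c
  for V :: "'v::ab_group_add smodule" and n v c +
  fixes X :: "('e::ab_group_add, 'v, 'v) extension"
  assumes ext: "is_extension V V X"
begin

sublocale X: schr_module "mid X"
  using ext by unfold_locales (simp add: is_extension_def)

lemma inc_hom: "smodule_hom V (mid X) (inc X)" and prj_hom: "smodule_hom (mid X) V (prj X)"
  using ext by (auto simp: is_extension_def)

lemmas inc_simps = smodule_homD[OF inc_hom] and prj_simps = smodule_homD[OF prj_hom]

lemma inc_eq_iff: "inc X a = inc X b \<longleftrightarrow> a = b"
  using ext by (auto simp: is_extension_def inj_eq)

lemma range_inc: "range (inc X) = {x. prj X x = 0}"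
  using ext by (auto simp: is_extension_def)

lemma prj_inc [simp]: "prj X (inc X a) = 0"
  using range_inc by auto

lemma linear_inc: "Vector_Spaces.linear sc X.sc (inc X)"
  unfolding Vector_Spaces.linear_iff
  by (simp add: vector_space_axioms X.vector_space_axioms inc_simps)

definition "u = inc X v"

lemma u_nonzero: "u \<noteq> 0"
  using inc_eq_iff[of v 0] v_nonzero by (simp add: u_def inc_simps)

lemma lowest_span_u: "y \<in> X.span {u} \<Longrightarrow> lowest (mid X) n y"
  by (rule X.lowest_in_span[of "{u}"]) (auto simp: u_def intro: smodule_hom_lowest[OF inc_hom] lowest_v)

lemma gen_span_u: "X.gen n (X.span {u}) = range (inc X)"
proof -
  interpret inc: Vector_Spaces.linear sc X.sc "inc X" by (rule linear_inc)
  have Y: "X.span {u} = inc X ` span {v}" using inc.span_image[of "{v}"] by (simp add: u_def)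
  have "gens (mid X) n (inc X ` span {v}) = inc X ` gens V n (span {v})"
    unfolding gens_def by (auto simp: image_iff) (metis smodule_hom_fp[OF inc_hom])+
  then show ?thesis using inc.span_image[of "gens V n (span {v})"] gen_v
    by (simp add: X.gen_def Y gen_def)
qed

lemma kernel_gen: "prj X x = 0 \<Longrightarrow> x \<in> X.gen n (X.span {u})"
  unfolding gen_span_u range_inc by simp

text \<open>The kernel of the projection is a copy of \<open>V\<close>, spanned by the eigenvectors
  \<open>f^i p^j u\<close>, so no other eigenvalue occurs there.\<close>

lemma T_eigen_0:
  assumes "prj X x = 0" "X.T x = X.sc m x" "\<And>i j. i \<le> n + j \<Longrightarrow> fp_eigenvalue n i j \<noteq> m"
  shows "x = 0"
proof -
  have "{fp (mid X) i j y | i j y. i \<le> n + j \<and> fp_eigenvalue n i j = m \<and> y \<in> X.span {u}} = {}"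
    using assms(3) by blast
  with X.T_eigenspace_gen[OF lowest_span_u kernel_gen[OF assms(1)] assms(2)]
  have "x \<in> X.span {}" by (simp only:)
  then show ?thesis by simp
qed

lemma T_eigen_u:
  assumes "prj X x = 0" "X.T x = X.sc (fp_eigenvalue n 0 0) x"
  shows "x \<in> X.span {u}"
  using X.T_eigenspace_gen_00[OF lowest_span_u X.subspace_span kernel_gen[OF assms(1)] assms(2)] .

text \<open>Any preimage of \<open>v\<close> is first corrected to a generalized eigenvector of the operator
  \<open>casimir_h\<close>. The eigenvalues that occur on the kernel of the projection then force every relation
  defining \<open>lowest\<close>, except that \<open>h x - n x\<close> could be a multiple of \<open>u\<close>; this is excluded by applying
  \<open>e\<close> to \<open>f\<^sup>n\<^sup>+\<^sup>1 x = 0\<close>.\<close>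

lemma lift_lowest: "\<exists>x. lowest (mid X) n x \<and> prj X x = v"
proof -
  let ?m = "fp_eigenvalue n 0 0"
  interpret T: Vector_Spaces.linear X.sc X.sc X.T by (rule X.linear_T)
  obtain x0 where x0: "prj X x0 = v" using ext unfolding is_extension_def by (metis surjD)
  have prT: "prj X (X.T x) = T (prj X x)" for x by (rule smodule_hom_casimir[OF prj_hom])
  have k0: "prj X (X.T x0 - X.sc ?m x0) = 0" by (simp add: prj_simps prT x0 T_lowest lowest_v)
  let ?S = "gens (mid X) n (X.span {u})"
  have S: "\<exists>l. X.T s = X.sc l s" if "s \<in> ?S" for s
    using that X.T_fp[OF lowest_span_u] by (auto simp: gens_def)
  \<comment> \<open>Subtracting \<open>y\<close>, which lies in the kernel, makes
    \<open>x0 - y\<close> satisfy \<open>(T - ?m)^2 = 0\<close>.\<close>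
  obtain y where y: "y \<in> X.span ?S"
    "X.T x0 - X.sc ?m x0 - (X.T y - X.sc ?m y) \<in> X.span {s \<in> ?S. X.T s = X.sc ?m s}"
    using X.eigenspace_correction[OF X.linear_T S] kernel_gen[OF k0] unfolding X.gen_def by blast
  define x where "x = x0 - y"
  have "y \<in> range (inc X)" using y(1) gen_span_u by (simp add: X.gen_def)
  then have py: "prj X y = 0" by auto
  then have px: "prj X x = v" by (simp add: x_def prj_simps x0)
  define w where "w = X.T x - X.sc ?m x"
  have Tx: "X.T x = X.sc ?m x + w" by (simp add: w_def)
  have "w \<in> X.span {s \<in> ?S. X.T s = X.sc ?m s}"
    using y(2) by (simp add: w_def x_def T.diff algebra_simps)
  moreover have "X.span {s \<in> ?S. X.T s = X.sc ?m s} \<subseteq> {w. X.T w = X.sc ?m w}"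
    by (rule X.span_minimal) (auto simp: X.subspace_def T.add T.scale T.zero X.scale_right_distrib mult.commute)
  ultimately have "X.T w = X.sc ?m w" by blast
  moreover have pw: "prj X w = 0" by (simp add: w_def prj_simps prT px T_lowest lowest_v)
  ultimately have "w \<in> X.span {u}" by (rule T_eigen_u[rotated])
  then have loww: "lowest (mid X) n w" by (rule lowest_span_u)
  have w: "X.E w = 0" "X.H w = X.sc (of_nat n) w" "(X.F ^^ Suc n) w = 0"
    using loww by (auto simp: lowest_def primitive_def)
  have v: "E v = 0" "H v = sc (of_nat n) v" "(F ^^ Suc n) v = 0" "lowering V (of_nat n) v = 0"
    using lowest_v by (auto simp: lowest_def primitive_def)
  have Ex: "X.E x = 0"
  proof (rule T_eigen_0)
    show "X.T (X.E x) = X.sc (?m + 2 * \<i>) (X.E x)"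
      by (simp add: X.T_E Tx X.act_linear w X.scale_left_distrib)
  qed (auto simp: prj_simps px v fp_eigenvalue_noteq)
  \<comment> \<open>The eigenvalue has index \<open>i = n + 1\<close>, \<open>j = 0\<close>, which
    the bound in \<open>gens\<close> excludes.\<close>
  have Fx: "(X.F ^^ Suc n) x = 0"
  proof (rule T_eigen_0)
    show "X.T ((X.F ^^ Suc n) x) = X.sc (fp_eigenvalue n (Suc n) 0) ((X.F ^^ Suc n) x)"
      unfolding X.T_funpow_F Tx X.funpow_linear w
      by (simp add: fp_eigenvalue_def algebra_simps flip: X.scale_left_distrib X.scale_left_diff_distrib)
    show "prj X ((X.F ^^ Suc n) x) = 0" unfolding smodule_hom_funpow[OF prj_hom] px by (rule v)
  qed (auto simp: fp_eigenvalue_eq_iff)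
  define d where "d = X.H x - X.sc (of_nat n) x"
  have "X.T d = X.sc ?m d"
    by (simp add: d_def T.diff T.scale X.T_H Tx X.act_linear w algebra_simps)
  moreover have "prj X d = 0" by (simp add: d_def prj_simps px v)
  ultimately have lowd: "lowest (mid X) n d" using T_eigen_u lowest_span_u by blast
  have "X.sc (of_nat (Suc n)) ((X.F ^^ n) d) = 0"
    using X.E_funpow_F[of n x] unfolding Fx Ex d_def by (simp del: of_nat_Suc)
  then have "(X.F ^^ n) d = 0" by (simp del: of_nat_Suc)
  then have "d = 0" using X.lowest_F_eq_0 lowd by blast
  then have prim: "primitive (mid X) (of_nat n) x" by (simp add: primitive_def Ex d_def)
  have "lowering (mid X) (of_nat n) x = 0"
  proof (rule T_eigen_0)
    show "X.T (lowering (mid X) (of_nat n) x) =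
      X.sc ((of_nat n - 1) * (of_nat n - 1 + 2) + \<i> * (of_nat n - 1)) (lowering (mid X) (of_nat n) x)"
      by (rule X.T_primitive[OF X.primitive_lowering[OF prim]])
    show "prj X (lowering (mid X) (of_nat n) x) = 0"
      using v by (simp add: lowering_def prj_simps px)
  qed (rule fp_eigenvalue_noteq)
  then show ?thesis using prim Fx px by (auto simp: lowest_def)
qed

lemma extension_top:
  assumes W: "submodule UNIV (mid X) W" and "range (inc X) \<subseteq> W" "x \<in> W" "prj X x = v"
  shows "W = UNIV"
proof -
  have "submodule UNIV V (prj X ` W)"
    using submodule_image[OF X.is_smodule is_smodule prj_hom W] .
  then have top: "prj X ` W = UNIV" using submodule_top assms(3,4) by blast
  have "y \<in> W" for y
  proof -
    obtain w where w: "w \<in> W" "prj X w = prj X y" using top by (metis UNIV_I imageE)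
    then have "prj X (y - w) = 0" by (simp add: prj_simps)
    then have "y - w \<in> W" using range_inc assms(2) by auto
    moreover have "X.subspace W" using W by (simp add: submodule_def)
    ultimately have "(y - w) + w \<in> W" using w(1) X.subspace_add by blast
    then show ?thesis by simp
  qed
  then show ?thesis by blast
qed

text \<open>For a lowest lift \<open>x\<close> of \<open>v\<close>, the vector
  \<open>z x - c x\<close> lies in the kernel with the eigenvalue of \<open>u\<close>, hence is
  \<open>b u\<close>. The vectors satisfying the parameter equation form a submodule that contains
  \<open>x\<close> and the kernel, so it is everything.\<close>

lemma parameter_exists: "\<exists>b. has_parameter X b"
proof -
  obtain x where x: "lowest (mid X) n x" "prj X x = v" using lift_lowest by blast
  interpret T: Vector_Spaces.linear X.sc X.sc X.T by (rule X.linear_T)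
  have "X.Z x - X.sc c x \<in> X.span {u}"
    by (rule T_eigen_u) (simp_all add: prj_simps x(2) Z_scalar T.diff T.scale X.T_Z X.T_lowest[OF x(1)] X.act_linear algebra_simps)
  then obtain b where b: "X.Z x - X.sc c x = X.sc b u" by (auto simp: X.span_singleton)
  let ?W = "{y. X.Z y = X.sc c y + inc X (sc b (prj X y))}"
  have "submodule UNIV (mid X) ?W"
    unfolding submodule_def X.subspace_def
    by (auto simp: X.act_linear prj_simps inc_simps scale_right_distrib X.scale_right_distrib mult.commute simp flip: X.act_Z_commute)
  moreover have "range (inc X) \<subseteq> ?W" by (auto simp: Z_scalar inc_simps simp flip: inc_simps(3))
  moreover have "x \<in> ?W" using b by (simp add: x(2) u_def inc_simps algebra_simps)
  ultimately have "?W = UNIV" using extension_top x(2) by blast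
  then show ?thesis unfolding has_parameter_def by blast
qed

lemma parameter_unique: 
  assumes "has_parameter X a" "has_parameter X b"
  shows "a = b"
proof -
  obtain x where "prj X x = v" using lift_lowest by blast
  then have "inc X (sc a v) = inc X (sc b v)" using assms unfolding has_parameter_def by (metis add_left_cancel)
  then show ?thesis using v_nonzero by (simp add: inc_eq_iff)
qed

end

section \<open>Comparison of two extensions inside their product\<close>

lemma prod_smodule_simps [simp]:
  "scl (prod_smodule M N) k (x, y) = (scl M k x, scl N k y)"
  "act (prod_smodule M N) a (x, y) = (act M a x, act N a y)"
  by (simp_all add: prod_smodule_def)

lemma is_smodule_prod:
  assumes "is_smodule M" "is_smodule N"
  shows "is_smodule (prod_smodule M N)"
proof -
  interpret M: schr_module M by standard fact
  interpret N: schr_module N by standard fact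
  have vs: "vector_space (scl (prod_smodule M N))"
    by unfold_locales (auto simp: M.scale_right_distrib N.scale_right_distrib M.scale_left_distrib N.scale_left_distrib)
  show ?thesis
    unfolding is_smodule_def Vector_Spaces.linear_iff
    using assms by (auto simp: vs M.act_linear N.act_linear M.act_add_left N.act_add_left
      M.act_scale_left N.act_scale_left vec.vector_space_axioms is_smodule_def)
qed

context schr_simple
begin

lemma same_parameter_equiv:
  fixes X :: "('e::ab_group_add, 'v, 'v) extension" and Y :: "('f::ab_group_add, 'v, 'v) extension"
  assumes X: "is_extension V V X" and Y: "is_extension V V Y"
    and param: "has_parameter X b" "has_parameter Y b"
  shows "ext_equiv X Y"
proof -
  interpret X: schr_self_extension V n v c X by unfold_locales fact
  interpret Y: schr_self_extension V n v c Y by unfold_locales fact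
  let ?N = "prod_smodule (mid X) (mid Y)"
  interpret N: schr_module ?N
    by unfold_locales (intro is_smodule_prod X.X.is_smodule Y.X.is_smodule)
  obtain x where x: "lowest (mid X) n x" "prj X x = v" using X.lift_lowest by blast
  obtain y where y: "lowest (mid Y) n y" "prj Y y = v" using Y.lift_lowest by blast
  have homs: "smodule_hom ?N (mid X) fst" "smodule_hom ?N (mid Y) snd"
    "smodule_hom V ?N (\<lambda>m. (inc X m, inc Y m))" "smodule_hom V ?N (\<lambda>m. (0, inc Y m))"
    by (auto simp: hom_on_def X.inc_simps Y.inc_simps)
  have pow: "(act ?N a ^^ i) (r, s) = ((act (mid X) a ^^ i) r, (act (mid Y) a ^^ i) s)" for a i r s
    by (induction i) simp_all
  have low: "lowest ?N n (r, s)" if "lowest (mid X) n r" "lowest (mid Y) n s" for r s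
    using that unfolding lowest_def primitive_def lowering_def pow by (auto simp: zero_prod_def)
  define U where "U = N.span {(x, y), (X.u, Y.u)}"
  have lowu: "lowest ?N n (X.u, Y.u)" unfolding X.u_def Y.u_def
    by (rule smodule_hom_lowest[OF homs(3) lowest_v])
  have lowU: "lowest ?N n r" if "r \<in> U" for r
    using that unfolding U_def by (rule N.lowest_in_span[rotated]) (use lowu low x y in auto)
  \<comment> \<open>Equality of the parameters enters here: both coordinates of
    \<open>z (x, y) - c (x, y)\<close> are the same multiple \<open>b\<close> of the copies of
    \<open>v\<close>.\<close>
  have ZU: "N.Z r \<in> U" if "r \<in> U" for r
    using that unfolding U_def
  proof (induction rule: N.span_induct_alt)
    case base then show ?case by (simp add: N.span_zero)
  next
    case (step k s t)
    have "N.Z (X.u, Y.u) = N.sc c (X.u, Y.u)"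
      using param by (simp add: has_parameter_def X.u_def Y.u_def X.inc_simps Y.inc_simps)
    moreover have "N.Z (x, y) = N.sc c (x, y) + N.sc b (X.u, Y.u)"
      using param by (simp add: has_parameter_def X.u_def Y.u_def x y X.inc_simps Y.inc_simps)
    ultimately have "N.Z s = N.sc c s \<or> N.Z s = N.sc c s + N.sc b (X.u, Y.u)"
      using step(1) by blast
    then have "N.Z s \<in> N.span {(x, y), (X.u, Y.u)}"
      using step(1) by (metis N.span_add N.span_scale N.span_base insertCI)
    then show ?case unfolding N.act_linear using step by (intro N.span_add N.span_scale)
  qed
  define G where "G = N.gen n U"
  have subU: "N.subspace U" by (simp add: U_def)
  have G: "submodule UNIV ?N G" unfolding G_def by (rule N.gen_submodule[OF subU lowU ZU])
  have UG: "(x, y) \<in> G" "(X.u, Y.u) \<in> G"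
    using N.subset_gen[of U n] N.span_base[of _ "{(x, y), (X.u, Y.u)}"] by (auto simp: G_def U_def)
  have "submodule UNIV ?N {(r, s). prj X r = prj Y s}"
    by (auto simp: submodule_def N.subspace_def X.prj_simps Y.prj_simps zero_prod_def)
  moreover have "U \<subseteq> {(r, s). prj X r = prj Y s}"
    unfolding U_def
    by (rule N.span_minimal) (auto simp: x y X.u_def Y.u_def N.subspace_def X.prj_simps Y.prj_simps zero_prod_def)
  ultimately have "G \<subseteq> {(r, s). prj X r = prj Y s}"
    unfolding G_def by (rule N.gen_subset)
  then have Gprj: "prj X r = prj Y s" if "(r, s) \<in> G" for r s using that by auto
  have diag: "(inc X m, inc Y m) \<in> G" for m
    using submodule_top[OF submodule_vimage[OF is_smodule N.is_smodule homs(3) G]] UG(2)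
    by (auto simp: X.u_def Y.u_def)
  have "fst ` G = UNIV"
  proof (rule X.extension_top)
    show "submodule UNIV (mid X) (fst ` G)" by (rule submodule_image[OF N.is_smodule X.X.is_smodule homs(1) G])
    show "range (inc X) \<subseteq> fst ` G" using diag by force
    show "x \<in> fst ` G" using UG(1) by force
  qed (rule x)
  then have total: "\<exists>s. (r, s) \<in> G" for r by (metis UNIV_I imageE prod.collapse)
  \<comment> \<open>The part of \<open>G\<close> in the second factor corresponds to a submodule of
    \<open>V\<close>. If it is not zero it contains the copy of \<open>v\<close>, which its
    eigenvalue forces into \<open>U\<close>; but \<open>U\<close> meets the second factor only in
    zero.\<close>
  have vert: "s = 0" if "(0, s) \<in> G" for s
  proof (rule ccontr)
    assume "s \<noteq> 0"
    have "prj Y s = 0" using Gprj[OF that] by (simp add: X.prj_simps)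
    then obtain m where m: "s = inc Y m" using Y.range_inc by blast
    have "{m. (0, inc Y m) \<in> G} = {0} \<or> {m. (0, inc Y m) \<in> G} = UNIV"
      by (rule simple_submodule_cases[OF simple submodule_vimage[OF is_smodule N.is_smodule homs(4) G]])
    moreover have "m \<noteq> 0" using \<open>s \<noteq> 0\<close> by (auto simp: m Y.inc_simps)
    ultimately have inG: "(0, inc Y v) \<in> G" using that m by auto
    have low0: "lowest ?N n (0, inc Y v)" by (rule smodule_hom_lowest[OF homs(4) lowest_v])
    have "(0, inc Y v) \<in> U"
      by (rule N.T_eigenspace_gen_00[OF lowU subU inG[unfolded G_def] N.T_lowest[OF low0]])
    then obtain k where "(0, inc Y v) - N.sc k (x, y) \<in> N.span {(X.u, Y.u)}"
      unfolding U_def using N.span_breakdown_eq[THEN iffD1] by blast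
    then obtain l where "(0, inc Y v) - N.sc k (x, y) = N.sc l (X.u, Y.u)"
      unfolding N.span_singleton by blast
    then have kl: "(0, inc Y v) = N.sc k (x, y) + N.sc l (X.u, Y.u)"
      unfolding diff_eq_eq by (subst add.commute)
    then have kl0: "0 = X.X.sc k x + X.X.sc l X.u" by simp
    from arg_cong[OF this, of "prj X"] have "k = 0"
      using v_nonzero by (simp add: X.prj_simps x X.u_def)
    then have "l = 0" using kl0 X.u_nonzero by simp
    then have "inc Y v = 0" using kl \<open>k = 0\<close> by simp
    then show False using Y.u_nonzero by (simp add: Y.u_def)
  qed
  have sG: "N.subspace G" using G by (simp add: submodule_def)
  have uniq: "s = t" if "(r, s) \<in> G" "(r, t) \<in> G" for r s t
    using vert[of "s - t"] N.subspace_diff[OF sG that] by simp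
  define \<phi> where "\<phi> r = (THE s. (r, s) \<in> G)" for r
  have \<phi>G: "(r, \<phi> r) \<in> G" for r unfolding \<phi>_def using total[of r] uniq by (metis theI)
  have \<phi>: "(r, s) \<in> G \<Longrightarrow> \<phi> r = s" for r s using uniq \<phi>G by blast
  show ?thesis
  proof (rule ext_equivI[OF X Y])
    show "smodule_hom (mid X) (mid Y) \<phi>"
      unfolding hom_on_def
    proof (intro conjI ballI allI; rule \<phi>)
      fix r s k a
      show "(r + s, \<phi> r + \<phi> s) \<in> G" using N.subspace_add[OF sG \<phi>G \<phi>G, of r s] by simp
      show "(X.X.sc k r, Y.X.sc k (\<phi> r)) \<in> G" using N.subspace_scale[OF sG \<phi>G, of k r] by simp
      have "act ?N a (r, \<phi> r) \<in> G" using G \<phi>G unfolding submodule_def by blast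
      then show "(act (mid X) a r, act (mid Y) a (\<phi> r)) \<in> G" by simp
    qed
    show "\<phi> (inc X m) = inc Y m" for m by (rule \<phi>[OF diag])
    show "prj Y (\<phi> r) = prj X r" for r using Gprj[OF \<phi>G] by simp
  qed
qed

end

section \<open>The standard extensions\<close>

text \<open>The derivation of the grading with \<open>sl2\<close> in degree 0, \<open>p\<close> and
  \<open>q\<close> in degree 1 and \<open>z\<close> in degree 2. It is not inner, since inner
  derivations kill the central \<open>z\<close>.\<close>

definition degree_derivation :: "schr \<Rightarrow> schr" where
  "degree_derivation a = (\<chi> i. case i of Bp \<Rightarrow> a $ Bp | Bq \<Rightarrow> a $ Bq | Bz \<Rightarrow> 2 * a $ Bz | _ \<Rightarrow> 0)"

lemma degree_derivation_linear:
  "degree_derivation (a + b) = degree_derivation a + degree_derivation b"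
  "degree_derivation (k *s a) = k *s degree_derivation a"
  by (simp_all add: degree_derivation_def vec_eq_iff algebra_simps split: schr_basis.split)

lemma degree_derivation_z: "degree_derivation b_z = 2 *s b_z"
  by (simp add: degree_derivation_def vec_eq_iff axis_def split: schr_basis.split)

lemma degree_derivation_bracket:
  "degree_derivation (bracket a b) = bracket (degree_derivation a) b + bracket a (degree_derivation b)"
  unfolding vec_eq_iff
proof
  fix i
  show "degree_derivation (bracket a b) $ i = (bracket (degree_derivation a) b + bracket a (degree_derivation b)) $ i"
    by (cases i) (simp_all add: degree_derivation_def bracket_def UNIV_basis axis_def algebra_simps)
qed

context schr_simple
begin

text \<open>The factor \<open>1 / (2 c)\<close> normalizes the parameter, because the derivation maps \<open>z\<close> to \<open>2 z\<close>.\<close>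

definition std_extension :: "complex \<Rightarrow> ('v \<times> 'v, 'v, 'v) extension" where
  "std_extension b = \<lparr>mid = \<lparr>scl = (\<lambda>k (x, y). (sc k x, sc k y)),
     act = (\<lambda>a (x, y). (act V a x, act V a y + sc (b / (2 * c)) (act V (degree_derivation a) x)))\<rparr>,
     inc = (\<lambda>y. (0, y)), prj = fst\<rparr>"

lemma std_extension_simps [simp]:
  "scl (mid (std_extension b)) k (x, y) = (sc k x, sc k y)"
  "act (mid (std_extension b)) a (x, y) =
     (act V a x, act V a y + sc (b / (2 * c)) (act V (degree_derivation a) x))"
  "inc (std_extension b) y = (0, y)"
  "prj (std_extension b) = fst"
  by (simp_all add: std_extension_def)

lemma act_bracket: "act V (bracket a b) x = act V a (act V b x) - act V b (act V a x)"
  using is_smodule by (simp add: is_smodule_def)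

text \<open>The Leibniz rule makes the off-diagonal term of the action a 1-cocycle, which is
  compatibility with the bracket.\<close>

lemma is_extension_std: "is_extension V V (std_extension b)"
proof -
  have vs: "vector_space (scl (mid (std_extension b)))"
    by unfold_locales (auto simp: scale_right_distrib scale_left_distrib)
  have "is_smodule (mid (std_extension b))"
    unfolding is_smodule_def Vector_Spaces.linear_iff
    by (auto simp: vs vec.vector_space_axioms act_linear act_add_left act_scale_left
        degree_derivation_linear degree_derivation_bracket act_bracket scale_right_distrib
        scale_right_diff_distrib mult.commute)
  then show ?thesis
    by (auto simp: is_extension_def hom_on_def inj_def surj_def)
qed

lemma has_parameter_std: "has_parameter (std_extension b) b"
  using c_nonzero
  by (auto simp: has_parameter_def degree_derivation_z act_scale_left Z_scalar)

section \<open>Equivalence classes as level sets of the parameter\<close>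

lemma has_parameter_equiv:
  assumes "is_extension V V X" "ext_equiv X Y" "has_parameter X b"
  shows "has_parameter Y b"
proof -
  obtain \<phi> where \<phi>: "smodule_hom (mid X) (mid Y) \<phi>" "bij \<phi>"
    "\<And>m. \<phi> (inc X m) = inc Y m" "\<And>x. prj Y (\<phi> x) = prj X x"
    using assms(2) by (auto simp: ext_equiv_def)
  have "act (mid Y) b_z (\<phi> x) = scl (mid Y) c (\<phi> x) + inc Y (sc b (prj Y (\<phi> x)))" for x
    using assms(3) by (simp add: has_parameter_def \<phi>(3,4) smodule_homD(1,2)[OF \<phi>(1)]
      flip: smodule_homD(3)[OF \<phi>(1)])
  then show ?thesis unfolding has_parameter_def using \<phi>(2) by (metis bij_pointE)
qed

definition parameter_class :: "complex \<Rightarrow> ('v, 'v) ext_class" where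
  "parameter_class b = {X \<in> extensions V V. has_parameter X b}"

lemma std_in_class: "std_extension b \<in> parameter_class b"
  by (simp add: parameter_class_def extensions_def is_extension_std has_parameter_std)

lemma unique_parameter:
  assumes "is_extension V V X" "has_parameter X a" "has_parameter X b"
  shows "a = b"
proof -
  interpret schr_self_extension V n v c X by unfold_locales fact
  show ?thesis using parameter_unique assms by blast
qed

lemma ex_parameter:
  assumes "is_extension V V X"
  shows "\<exists>b. has_parameter X b"
proof -
  interpret schr_self_extension V n v c X by unfold_locales fact
  show ?thesis by (rule parameter_exists)
qed

lemma inj_parameter_class: "inj parameter_class"
proof (rule injI)
  fix a b assume "parameter_class a = parameter_class b"
  then have "std_extension a \<in> parameter_class b" using std_in_class by metis
  then show "a = b"
    using unique_parameter[OF is_extension_std has_parameter_std] by (simp add: parameter_class_def)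
qed

lemma equiv_class_eq:
  assumes "X \<in> extensions V V" "has_parameter X b"
  shows "{(X, Y). X \<in> extensions V V \<and> Y \<in> extensions V V \<and> ext_equiv X Y} `` {X} = parameter_class b"
  using assms same_parameter_equiv has_parameter_equiv
  by (auto simp: parameter_class_def extensions_def)

lemma Ext1_eq: "Ext1 V V = range parameter_class"
proof
  show "Ext1 V V \<subseteq> range parameter_class"
    unfolding Ext1_def
  proof
    fix \<xi> assume "\<xi> \<in> extensions V V // {(X, Y). X \<in> extensions V V \<and> Y \<in> extensions V V \<and> ext_equiv X Y}"
    then obtain X where X: "X \<in> extensions V V"
      "\<xi> = {(X, Y). X \<in> extensions V V \<and> Y \<in> extensions V V \<and> ext_equiv X Y} `` {X}"
      by (auto elim: quotientE)
    then obtain b where "has_parameter X b" using ex_parameter by (auto simp: extensions_def)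
    then show "\<xi> \<in> range parameter_class" using equiv_class_eq[OF X(1)] X(2) by blast
  qed
  show "range parameter_class \<subseteq> Ext1 V V"
  proof
    fix \<xi> assume "\<xi> \<in> range parameter_class"
    then obtain b where b: "\<xi> = parameter_class b" by blast
    have std: "std_extension b \<in> extensions V V" by (simp add: extensions_def is_extension_std)
    show "\<xi> \<in> Ext1 V V" unfolding Ext1_def b
      using quotientI[OF std, of "{(X, Y). X \<in> extensions V V \<and> Y \<in> extensions V V \<and> ext_equiv X Y}"]
      unfolding equiv_class_eq[OF std has_parameter_std] .
  qed
qed

section \<open>Baer sums and scalar multiples in terms of the parameter\<close>

lemma baer_sum_parameter:
  assumes X1: "is_extension V V X1" "has_parameter X1 a" and X2: "is_extension V V X2" "has_parameter X2 b"
    and Y: "is_baer_sum X1 X2 Y"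
  shows "has_parameter Y (a + b)"
  unfolding has_parameter_def
proof
  interpret X1: schr_self_extension V n v c X1 by unfold_locales fact
  interpret X2: schr_self_extension V n v c X2 by unfold_locales fact
  let ?N = "prod_smodule (mid X1) (mid X2)"
  obtain \<phi> where \<phi>: "hom_on UNIV ?N (pullback X1 X2) (mid Y) \<phi>" "\<phi> ` pullback X1 X2 = UNIV"
    "{u \<in> pullback X1 X2. \<phi> u = 0} = range (\<lambda>n. (inc X1 n, - inc X2 n))"
    "\<And>n. inc Y n = \<phi> (inc X1 n, 0)"
    "\<And>x y. (x, y) \<in> pullback X1 X2 \<Longrightarrow> prj Y (\<phi> (x, y)) = prj X1 x"
    using Y unfolding is_baer_sum_def by blast
  note hom = \<phi>(1)[unfolded hom_on_def]
  fix y
  obtain r s where rs: "(r, s) \<in> pullback X1 X2" "y = \<phi> (r, s)" using \<phi>(2) by (metis UNIV_I imageE prod.collapse)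
  define m where "m = prj X1 r"
  have prs: "prj X1 r = m" "prj X2 s = m" using rs(1) by (auto simp: m_def pullback_def)
  have in_pb: "(X1.X.sc c r, X2.X.sc c s) \<in> pullback X1 X2" "\<And>k. (inc X1 k, 0) \<in> pullback X1 X2"
    "\<And>k. (0, inc X2 k) \<in> pullback X1 X2" "\<And>k l. (inc X1 k, inc X2 l) \<in> pullback X1 X2"
    by (simp_all add: pullback_def X1.prj_simps X2.prj_simps prs)
  \<comment> \<open>Dividing by the skew diagonal identifies the two copies of \<open>V\<close>, so
    the contributions of \<open>a\<close> and \<open>b\<close> land in the same copy.\<close>
  have skew: "\<phi> (0, inc X2 k) = inc Y k" for k
  proof -
    have z: "\<phi> (inc X1 k, - inc X2 k) = 0" and p: "(inc X1 k, - inc X2 k) \<in> pullback X1 X2"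
      using \<phi>(3) by auto
    have "\<phi> ((inc X1 k, - inc X2 k) + (0, inc X2 k)) = \<phi> (inc X1 k, - inc X2 k) + \<phi> (0, inc X2 k)"
      using hom p in_pb(3) by blast
    then show ?thesis by (simp add: z \<phi>(4))
  qed
  have "act (mid Y) b_z y = \<phi> (act ?N b_z (r, s))" using hom rs by (simp del: prod_smodule_simps)
  also have "act ?N b_z (r, s) = scl ?N c (r, s) + ((inc X1 (sc a m), 0) + (0, inc X2 (sc b m)))"
    using X1(2) X2(2) by (simp add: has_parameter_def prs)
  also have "\<phi> \<dots> = \<phi> (scl ?N c (r, s)) + \<phi> ((inc X1 (sc a m), 0) + (0, inc X2 (sc b m)))"
  proof -
    have "scl ?N c (r, s) \<in> pullback X1 X2" "(inc X1 (sc a m), 0) + (0, inc X2 (sc b m)) \<in> pullback X1 X2"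
      using in_pb by simp_all
    then show ?thesis using hom by blast
  qed
  also have "\<phi> (scl ?N c (r, s)) = scl (mid Y) c y" using hom rs by (simp del: prod_smodule_simps)
  also have "\<phi> ((inc X1 (sc a m), 0) + (0, inc X2 (sc b m))) = inc Y (sc a m) + inc Y (sc b m)"
  proof -
    have "\<phi> ((inc X1 (sc a m), 0) + (0, inc X2 (sc b m))) = \<phi> (inc X1 (sc a m), 0) + \<phi> (0, inc X2 (sc b m))"
      using hom in_pb(2,3) by blast
    then show ?thesis by (simp add: skew \<phi>(4))
  qed
  \<comment> \<open>Here \<open>Y\<close> is known only as a Baer sum, so additivity of
    \<open>inc Y\<close> is read off from \<open>\<phi>\<close>.\<close>
  also have "inc Y (sc a m) + inc Y (sc b m) = inc Y (sc (a + b) m)"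
  proof -
    have "\<phi> ((inc X1 (sc a m), 0) + (inc X1 (sc b m), 0)) = \<phi> (inc X1 (sc a m), 0) + \<phi> (inc X1 (sc b m), 0)"
      using hom in_pb(2) by blast
    then show ?thesis by (simp add: \<phi>(4) scale_left_distrib X1.inc_simps)
  qed
  also have "m = prj Y y" using \<phi>(5)[OF rs(1)] by (simp add: rs m_def)
  finally show "act (mid Y) b_z y = scl (mid Y) c y + inc Y (sc (a + b) (prj Y y))" .
qed

text \<open>On standard extensions the sum is explicit: over a common first coordinate the second
  coordinates add, and so do the cocycles. The equivalence \<open>\<psi>\<close> carries the result
  to \<open>Y\<close>.\<close>

lemma std_baer_sum:
  assumes "is_extension V V Y" "has_parameter Y (a + b)"
  shows "is_baer_sum (std_extension a) (std_extension b) Y"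
proof -
  have "ext_equiv (std_extension (a + b)) Y"
    by (rule same_parameter_equiv[OF is_extension_std assms(1) has_parameter_std assms(2)])
  then obtain \<psi> where \<psi>: "smodule_hom (mid (std_extension (a + b))) (mid Y) \<psi>" "bij \<psi>"
    "\<And>m. \<psi> (inc (std_extension (a + b)) m) = inc Y m" "\<And>x. prj Y (\<psi> x) = prj (std_extension (a + b)) x"
    by (auto simp: ext_equiv_def)
  let ?\<phi> = "\<lambda>((m, k), (m', l)). \<psi> (m, k + l)"
  have \<psi>0: "\<psi> x = 0 \<longleftrightarrow> x = 0" for x
    using \<psi>(2) smodule_homD(4)[OF \<psi>(1)] by (metis bij_pointE)
  show ?thesis
    unfolding is_baer_sum_def
  proof (intro exI[of _ ?\<phi>] conjI allI)
    show "hom_on UNIV (prod_smodule (mid (std_extension a)) (mid (std_extension b)))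
       (pullback (std_extension a) (std_extension b)) (mid Y) ?\<phi>"
      unfolding hom_on_def pullback_def
      by (auto simp: algebra_simps scale_left_distrib act_linear add_divide_distrib
          simp flip: smodule_homD(1-3)[OF \<psi>(1)])
    show "?\<phi> ` pullback (std_extension a) (std_extension b) = UNIV"
    proof (intro equalityI subsetI UNIV_I)
      fix y obtain m k where "y = \<psi> (m, k)" using \<psi>(2) by (metis bij_pointE surj_pair)
      then show "y \<in> ?\<phi> ` pullback (std_extension a) (std_extension b)"
        by (intro rev_image_eqI[of "((m, k), (m, 0))"]) (auto simp: pullback_def)
    qed
    show "{u \<in> pullback (std_extension a) (std_extension b). ?\<phi> u = 0} =
      range (\<lambda>n. (inc (std_extension a) n, - inc (std_extension b) n))"
      by (auto simp: pullback_def \<psi>0 zero_prod_def add_eq_0_iff image_iff)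
    show "inc Y m = ?\<phi> (inc (std_extension a) m, 0)" for m
      using \<psi>(3)[of m] by (simp add: zero_prod_def)
    show "\<forall>(x, y)\<in>pullback (std_extension a) (std_extension b). prj Y (?\<phi> (x, y)) = prj (std_extension a) x"
      by (auto simp: \<psi>(4))
  qed
qed

lemma ext_add_class: "ext_add V V (parameter_class a) (parameter_class b) = parameter_class (a + b)"
proof (intro equalityI subsetI)
  fix Y assume "Y \<in> ext_add V V (parameter_class a) (parameter_class b)"
  then show "Y \<in> parameter_class (a + b)"
    using baer_sum_parameter by (auto simp: ext_add_def parameter_class_def extensions_def)
next
  fix Y assume Y: "Y \<in> parameter_class (a + b)"
  then have "is_baer_sum (std_extension a) (std_extension b) Y"
    by (intro std_baer_sum) (auto simp: parameter_class_def extensions_def)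
  then show "Y \<in> ext_add V V (parameter_class a) (parameter_class b)"
    using Y std_in_class unfolding ext_add_def by (auto simp: parameter_class_def[of "a + b"])
qed

text \<open>For a lift \<open>x\<close> of \<open>v\<close>, the vector \<open>z \<phi>(x)\<close>
  is computed once in \<open>Y\<close> and once as the image of \<open>z x\<close>.\<close>

lemma scalar_multiple_parameter:
  assumes X: "is_extension V V X" "has_parameter X a" and Y: "is_extension V V Y"
    and mult: "is_scalar_multiple V k X Y"
  shows "has_parameter Y (k * a)"
proof -
  interpret X: schr_self_extension V n v c X by unfold_locales fact
  interpret Y: schr_self_extension V n v c Y by unfold_locales fact
  obtain \<phi> where \<phi>: "smodule_hom (mid X) (mid Y) \<phi>"
    "\<And>n. \<phi> (inc X n) = inc Y (sc k n)" "\<And>x. prj Y (\<phi> x) = prj X x"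
    using mult by (auto simp: is_scalar_multiple_def)
  obtain b where b: "has_parameter Y b" using Y.parameter_exists by blast
  obtain x where x: "prj X x = v" using X.lift_lowest by blast
  have "Y.X.sc c (\<phi> x) + inc Y (sc b v) = Y.X.Z (\<phi> x)"
    using b by (simp add: has_parameter_def \<phi>(3) x)
  also have "\<dots> = \<phi> (X.X.sc c x + inc X (sc a v))"
    using X(2) by (simp add: has_parameter_def x flip: smodule_homD(3)[OF \<phi>(1)])
  also have "\<dots> = Y.X.sc c (\<phi> x) + inc Y (sc (k * a) v)"
    by (simp add: smodule_homD[OF \<phi>(1)] \<phi>(2))
  finally have "b = k * a" using v_nonzero by (simp add: Y.inc_eq_iff)
  then show ?thesis using b by simp
qed

text \<open>Multiplying the second coordinate by \<open>k\<close> multiplies the cocycle by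
  \<open>k\<close>.\<close>

lemma std_scalar_multiple:
  assumes "is_extension V V Y" "has_parameter Y (k * a)"
  shows "is_scalar_multiple V k (std_extension a) Y"
proof -
  have "ext_equiv (std_extension (k * a)) Y"
    by (rule same_parameter_equiv[OF is_extension_std assms(1) has_parameter_std assms(2)])
  then obtain \<psi> where \<psi>: "smodule_hom (mid (std_extension (k * a))) (mid Y) \<psi>"
    "\<And>m. \<psi> (inc (std_extension (k * a)) m) = inc Y m" "\<And>x. prj Y (\<psi> x) = prj (std_extension (k * a)) x"
    by (auto simp: ext_equiv_def)
  show ?thesis
    unfolding is_scalar_multiple_def
  proof (intro exI[of _ "\<lambda>(m, l). \<psi> (m, sc k l)"] conjI allI)
    show "smodule_hom (mid (std_extension a)) (mid Y) (\<lambda>(m, l). \<psi> (m, sc k l))"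
      unfolding hom_on_def
      by (auto simp: scale_right_distrib act_linear mult.commute simp flip: smodule_homD(1-3)[OF \<psi>(1)])
    show "(case inc (std_extension a) m of (m, l) \<Rightarrow> \<psi> (m, sc k l)) = inc Y (sc k m)" for m
      using \<psi>(2)[of "sc k m"] by simp
    show "prj Y (case x of (m, l) \<Rightarrow> \<psi> (m, sc k l)) = prj (std_extension a) x" for x
      by (cases x) (simp add: \<psi>(3))
  qed
qed

lemma ext_scale_class: "ext_scale V V k (parameter_class a) = parameter_class (k * a)"
proof (intro equalityI subsetI)
  fix Y assume "Y \<in> ext_scale V V k (parameter_class a)"
  then show "Y \<in> parameter_class (k * a)"
    using scalar_multiple_parameter by (auto simp: ext_scale_def parameter_class_def extensions_def)
next
  fix Y assume Y: "Y \<in> parameter_class (k * a)"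
  then have "is_scalar_multiple V k (std_extension a) Y"
    by (intro std_scalar_multiple) (auto simp: parameter_class_def extensions_def)
  then show "Y \<in> ext_scale V V k (parameter_class a)"
    using Y std_in_class unfolding ext_scale_def by (auto simp: parameter_class_def[of "k * a"])
qed

lemma Ext1_complex_line: "isomorphic_to_complex_line (Ext1 V V) (ext_add V V) (ext_scale V V)"
  unfolding isomorphic_to_complex_line_def Ext1_eq
proof (intro conjI exI[of _ "inv parameter_class"])
  show "bij_betw (inv parameter_class) (range parameter_class) UNIV"
    by (rule bij_betw_inv_into) (rule inj_on_imp_bij_betw[OF inj_parameter_class])
qed (auto simp: ext_add_class ext_scale_class inv_f_f[OF inj_parameter_class])

end

theorem theorem55:
  fixes V :: "'v::ab_group_add smodule"
  assumes "is_smodule V"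
    and "simple_smodule V"
    and "\<not> fin_dim V UNIV"
    and "harish_chandra V"
  shows "isomorphic_to_complex_line (Ext1 V V) (ext_add V V) (ext_scale V V)"
proof -
  interpret schr_module V by unfold_locales fact
  have "(UNIV :: 'v set) \<noteq> {0}" using assms(2) by (simp add: simple_smodule_def simple_submodule_def)
  then obtain n v where v: "v \<noteq> 0" "lowest V n v" using lowest_exists assms(4) by blast
  obtain c where c: "\<And>x. Z x = sc c x" using central_character[OF assms(2) v] by blast
  interpret schr_simple V n v c
    using assms v c central_character_nonzero[OF assms(2) v c assms(3)] by unfold_locales auto
  show ?thesis by (rule Ext1_complex_line)
qed

end
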